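(* Let $m\ge 1$ be an integer. In the polynomial ring in the six variables $x_0,x_1,s_0,s_1,t_0,t_1$ let $$Q=(x_0+x_1)(s_0+s_1)^m(t_0+t_1)^m,$$ $$P_\ell=\binom{m}{\ell}\Big[x_0\,s_0^{\ell}s_1^{m-\ell}(t_0+t_1)^m+x_1\,t_0^{\ell}t_1^{m-\ell}(s_0+s_1)^m\Big],\qquad \ell=0,1,\dots,m.$$ Then the polytope given by the Minkowski sum $$\mathcal{N}(Q)+\mathcal{N}(P_0)+\mathcal{N}(P_1)+\cdots+\mathcal{N}(P_m)\subset\mathbb{R}^6,$$ which is $3$-dimensional, has $8(m+1)$ vertices, $14m+12$ edges and $6(m+1)$ facets. Each of the eight vertices of the (combinatorial) cube $\mathcal{N}(Q)$ is a summand of $m+1$ vertices. Among the $6(m+1)$ facets, four are pentagons, two are $2(m+1)$-gons and the remaining ones are quadrilaterals.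
   Context: $\mathcal{N}(F)$ denotes the Newton polytope of a polynomial $F$, i.e. the convex hull of its exponent vectors in $\mathbb{R}^6$. Every vertex $v$ of a Minkowski sum of polytopes decomposes uniquely as a sum of vertices of the summands; a vertex $u$ of $\mathcal{N}(Q)$ is "a summand of" $v$ if $u$ is the $\mathcal{N}(Q)$-component in this decomposition. *)

theory Defs
  imports "HOL-Analysis.Analysis" "HOL-Library.Poly_Mapping"
begin

datatype var = X0 | X1 | S0 | S1 | T0 | T1

lemma UNIV_var: "UNIV = {X0, X1, S0, S1, T0, T1}"
  using var.exhaust by blast

instance var :: finite
  by standard (simp add: UNIV_var)

lemma CARD_var: "CARD(var) = 6"
  by (simp add: UNIV_var)

(* The polynomial ring in the variables var over 'k: finitely supported functions from
   exponent vectors to coefficients, multiplied by convolution.  Since CARD(var) = 6,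
   real^var is R^6 with coordinates labelled by the variables. *)
type_synonym 'k poly6 = "(var \<Rightarrow>\<^sub>0 nat) \<Rightarrow>\<^sub>0 'k"

definition Var :: "var \<Rightarrow> 'k::comm_semiring_1 poly6" where
  "Var i = Poly_Mapping.single (Poly_Mapping.single i 1) 1"

definition Q :: "nat \<Rightarrow> 'k::comm_semiring_1 poly6" where
  "Q m = (Var X0 + Var X1) * (Var S0 + Var S1) ^ m * (Var T0 + Var T1) ^ m"

definition P :: "nat \<Rightarrow> nat \<Rightarrow> 'k::comm_semiring_1 poly6" where
  "P m l = of_nat (m choose l) *
     (Var X0 * Var S0 ^ l * Var S1 ^ (m - l) * (Var T0 + Var T1) ^ m +
      Var X1 * Var T0 ^ l * Var T1 ^ (m - l) * (Var S0 + Var S1) ^ m)"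

definition exponent_vector :: "(var \<Rightarrow>\<^sub>0 nat) \<Rightarrow> real^var" where
  "exponent_vector e = (\<chi> i. real (Poly_Mapping.lookup e i))"

definition newton_polytope :: "'k::zero poly6 \<Rightarrow> (real^var) set" where
  "newton_polytope F = convex hull (exponent_vector ` Poly_Mapping.keys F)"

definition vertices :: "'a::euclidean_space set \<Rightarrow> 'a set" where
  "vertices K = {v. v extreme_point_of K}"

definition edges :: "'a::euclidean_space set \<Rightarrow> 'a set set" where
  "edges K = {e. e edge_of K}"

definition facets :: "'a::euclidean_space set \<Rightarrow> 'a set set" where
  "facets K = {F. F facet_of K}"

definition is_ngon :: "nat \<Rightarrow> 'a::euclidean_space set \<Rightarrow> bool" where
  "is_ngon n F \<longleftrightarrow> polytope F \<and> aff_dim F = 2 \<and> card (vertices F) = n"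

(* isomorphism of face lattices *)
definition combinatorially_equivalent ::
    "'a::euclidean_space set \<Rightarrow> 'b::euclidean_space set \<Rightarrow> bool" where
  "combinatorially_equivalent K L \<longleftrightarrow>
     (\<exists>\<phi>. bij_betw \<phi> {F. F face_of K} {G. G face_of L} \<and>
          (\<forall>F F'. F face_of K \<longrightarrow> F' face_of K \<longrightarrow> (F \<subseteq> F' \<longleftrightarrow> \<phi> F \<subseteq> \<phi> F')))"

definition combinatorial_cube :: "'a::euclidean_space set \<Rightarrow> bool" where
  "combinatorial_cube K \<longleftrightarrow> polytope K \<and> combinatorially_equivalent K (cbox 0 1 :: (real^3) set)"

(* u is the K-component of a decomposition of v, a vertex of the Minkowski sum of K and the
   L i for i in I, into vertices of the summands; such a decomposition of a vertex of the
   sum is unique, so "a" decomposition is "the" decomposition. *)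
definition is_summand_of ::
    "'a::euclidean_space set \<Rightarrow> 'i set \<Rightarrow> ('i \<Rightarrow> 'a set) \<Rightarrow> 'a \<Rightarrow> 'a \<Rightarrow> bool" where
  "is_summand_of K I L u v \<longleftrightarrow>
     v \<in> vertices (K + (\<Sum>i\<in>I. L i)) \<and> u \<in> vertices K \<and>
     (\<exists>w. (\<forall>i\<in>I. w i \<in> vertices (L i)) \<and> v = u + (\<Sum>i\<in>I. w i))"

end

theory Submission
  imports Defs
begin

text \<open>
The proof determines the normal fan of the Minkowski sum explicitly.

Let $x, s, t$ be the exponents of $x_0, s_0, t_0$; the other three exponents are $1 - x$, $m - s$, $m - t$
for every summand. Then the Newton polytope of $Q$ is the box $[0,1] \times [0,m]^2$, and that of $P_l$ is a
tetrahedron with an upper edge $x = 1$, $s = l$, $0 \le t \le m$ and a lower edge $x = 0$, $t = l$,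
$0 \le s \le m$. This reading of the Newton polytopes uses that no cancellation occurs, because all
coefficients are natural numbers and the characteristic is zero (\<open>newton_polytope_Q\<close>,
\<open>newton_polytope_P\<close>).

A linear functional acts on the sum through three numbers $(a, b, c)$, its slopes in $x, s, t$. A vertex of
the sum is a choice of one vertex of every summand such that a common functional is maximal on each summand exactly at
the chosen vertex. The signs of $a, b, c$ choose the vertex of the box, and they also choose an end of the
upper and of the lower edge of every tetrahedron. What remains is, for every $l$, the choice between the two
edges, decided by the sign of \<open>gain\<close>,
\[ a - (m - l)(b^+ - c^+) - l(b^- - c^-), \]
which is affine in $l$. Hence the $l$ that choose the upper edge form an initial or a final segment of
$\{0, \dots, m\}$, and the vertices can be labelled by three signs and one number $r \le m$: this gives $m + 1$
vertices for each vertex of the box, $8(m + 1)$ in all. The label determines the normal cone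
(\<open>cone_plus_plus\<close>, \<open>cone_plus_minus\<close>).

The set \<open>peak m a b c\<close> of labels whose vertices are maximal in the direction $(a, b, c)$ is the vertex set of a
face, and every nonempty face arises in this way. So the face lattice is the family of all peaks. As the labelled
points are in convex position, a face is an edge exactly if its peak has two elements, and a facet exactly if its
peak is proper and has at least three elements (\<open>edges_hull\<close>, \<open>facets_hull\<close>); no dimension has to be computed
apart from the bound $3$ for the whole sum. It remains to list all peaks. Two symmetries of the configuration,
\<open>swap\<close> and \<open>flip\<close>, reduce the directions to a few sectors of the $(b, c)$-plane. In each sector the
thresholds for $a$ at which $r$ changes are strictly monotone in $r$, so that at most two consecutive values of $r$
occur together. The result is \<open>peak_cells\<close> (each peak is everything, a facet, an edge or a vertex
from an explicit list) and, conversely, \<open>edge_peaks\<close> and \<open>facet_peaks\<close> (all members of the lists occur).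
Counting the lists gives $14m + 12$ edges and $6(m + 1)$ facets, and the sizes of the facet lists give the
polygon types.
\<close>

section \<open>Polytopes spanned by points in convex position\<close>

text \<open>Each point of the finite family is the unique maximum of some linear functional. This is a form of
convex position that also says that distinct indices carry distinct points, and it is what an explicit description
of the normal cones provides.\<close>

locale convex_position =
  fixes I :: "'i set" and pt :: "'i \<Rightarrow> 'a::euclidean_space"
  assumes finite_index: "finite I" and nonempty_index: "I \<noteq> {}"
    and exposed: "\<And>i. i \<in> I \<Longrightarrow> \<exists>w. {j \<in> I. \<forall>k\<in>I. w \<bullet> pt k \<le> w \<bullet> pt j} = {i}"
begin

definition extremal :: "'a \<Rightarrow> 'i set" where
  "extremal w = {j \<in> I. \<forall>k\<in>I. w \<bullet> pt k \<le> w \<bullet> pt j}"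

abbreviation hull_of :: "'i set \<Rightarrow> 'a set" where
  "hull_of J \<equiv> convex hull (pt ` J)"

lemma extremal_subset: "extremal w \<subseteq> I" by (auto simp: extremal_def)

lemma extremal_nonempty: "extremal w \<noteq> {}"
proof -
  let ?S = "(\<lambda>k. w \<bullet> pt k) ` I"
  have "Max ?S \<in> ?S" using finite_index nonempty_index by (intro Max_in) auto
  then obtain j where j: "j \<in> I" "w \<bullet> pt j = Max ?S" by auto
  have "w \<bullet> pt k \<le> w \<bullet> pt j" if "k \<in> I" for k
    unfolding j(2) using finite_index that by (intro Max_ge) auto
  with j(1) show ?thesis by (auto simp: extremal_def)
qed

lemma exposed_extremal: "i \<in> I \<Longrightarrow> \<exists>w. extremal w = {i}"
  unfolding extremal_def by (rule exposed)

lemma inj_pt: "inj_on pt I"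
proof (rule inj_onI)
  fix i j assume ij: "i \<in> I" "j \<in> I" "pt i = pt j"
  obtain w where w: "extremal w = {i}" using exposed_extremal[OF ij(1)] by blast
  then have "i \<in> extremal w" by simp
  then have "j \<in> extremal w" using ij by (simp add: extremal_def)
  then show "i = j" using w by simp
qed

lemma face_of_hull_eq:
  assumes "F face_of hull_of I"
  obtains J where "J \<subseteq> I" "F = hull_of J"
proof -
  have "compact (pt ` I)" using finite_index by (simp add: finite_imp_compact)
  then obtain S where "S \<subseteq> pt ` I" "F = convex hull S"
    using face_of_convex_hull_subset[OF _ assms] by blast
  then show thesis using that by (metis subset_image_iff)
qed

lemma supporting_face:
  assumes "\<And>k. k \<in> I \<Longrightarrow> w \<bullet> pt k \<le> c" and "j \<in> I" "w \<bullet> pt j = c"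
  shows "hull_of I \<inter> {x. w \<bullet> x = c} = hull_of (extremal w)" and "hull_of (extremal w) face_of hull_of I"
proof -
  have le: "w \<bullet> x \<le> c" if "x \<in> hull_of I" for x
  proof -
    have "hull_of I \<subseteq> {x. w \<bullet> x \<le> c}"
      by (rule hull_minimal) (use assms(1) in \<open>auto simp: convex_halfspace_le\<close>)
    then show ?thesis using that by auto
  qed
  have top: "extremal w = {k \<in> I. w \<bullet> pt k = c}"
    using assms by (force simp: extremal_def)
  let ?F = "hull_of I \<inter> {x. w \<bullet> x = c}"
  have face: "?F face_of hull_of I"
    by (rule face_of_Int_supporting_hyperplane_le) (use le in auto)
  show "?F = hull_of (extremal w)"
  proof
    obtain J where J: "J \<subseteq> I" "?F = hull_of J" using face_of_hull_eq[OF face] by blast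
    have "pt ` J \<subseteq> ?F" unfolding J(2) by (rule hull_subset)
    then have "J \<subseteq> extremal w" using J(1) by (auto simp: top)
    then show "?F \<subseteq> hull_of (extremal w)" unfolding J(2) by (intro hull_mono image_mono)
    show "hull_of (extremal w) \<subseteq> ?F"
      by (rule hull_minimal)
        (auto simp: top intro!: convex_Int convex_hyperplane hull_inc)
  qed
  then show "hull_of (extremal w) face_of hull_of I" using face by simp
qed

text \<open>Faces of a polytope are exposed, so a nonempty face is determined by the indices that are maximal in one
direction. All questions about faces become questions about the sets \<open>extremal w\<close>.\<close>

lemma nonempty_face_iff: "F face_of hull_of I \<and> F \<noteq> {} \<longleftrightarrow> (\<exists>w. F = hull_of (extremal w))"
proof
  assume F: "F face_of hull_of I \<and> F \<noteq> {}"
  have "polyhedron (hull_of I)"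
    using finite_index by (intro polytope_imp_polyhedron polytope_convex_hull) simp
  then have "F exposed_face_of hull_of I" using F exposed_face_of_polyhedron by blast
  then obtain w c where w: "hull_of I \<subseteq> {x. w \<bullet> x \<le> c}" "F = hull_of I \<inter> {x. w \<bullet> x = c}"
    by (auto simp: exposed_face_of_def)
  obtain J where J: "J \<subseteq> I" "F = hull_of J" using face_of_hull_eq F by blast
  with F obtain j where j: "j \<in> J" by fastforce
  have "pt j \<in> F" unfolding J(2) using j by (intro hull_inc) auto
  then have "F = hull_of (extremal w)"
    unfolding w(2) using j J(1) w(1)
    by (intro supporting_face(1)) (auto simp: hull_inc subset_iff)
  then show "\<exists>w. F = hull_of (extremal w)" ..
next
  assume "\<exists>w. F = hull_of (extremal w)"
  then obtain w where F: "F = hull_of (extremal w)" ..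
  obtain j where "j \<in> extremal w" using extremal_nonempty by blast
  then show "F face_of hull_of I \<and> F \<noteq> {}"
    using F supporting_face(2)[of w "w \<bullet> pt j" j] by (auto simp: extremal_def)
qed

lemma vertices_hull_of:
  assumes "J \<subseteq> I"
  shows "vertices (hull_of J) = pt ` J"
proof
  show "vertices (hull_of J) \<subseteq> pt ` J"
    by (auto simp: vertices_def dest: extreme_point_of_convex_hull)
  show "pt ` J \<subseteq> vertices (hull_of J)"
  proof
    fix x assume "x \<in> pt ` J"
    then obtain i where i: "i \<in> J" "x = pt i" by blast
    then obtain w where "extremal w = {i}" using exposed_extremal[of i] assms by blast
    then have "hull_of (extremal w) = {x}" using i by simp
    then have "{x} face_of hull_of I" using nonempty_face_iff[of "{x}"] by blast
    then have "x extreme_point_of hull_of I" by (simp add: face_of_singleton)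
    moreover have "hull_of J \<subseteq> hull_of I" using assms by (intro hull_mono image_mono)
    moreover have "x \<in> hull_of J" using i by (auto intro: hull_inc)
    ultimately show "x \<in> vertices (hull_of J)" by (auto simp: vertices_def extreme_point_of_def subset_iff)
  qed
qed

lemma card_vertices_hull_of: "J \<subseteq> I \<Longrightarrow> card (vertices (hull_of J)) = card J"
  by (simp add: vertices_hull_of card_image inj_on_subset[OF inj_pt])

lemma hull_of_inject: "J \<subseteq> I \<Longrightarrow> K \<subseteq> I \<Longrightarrow> hull_of J = hull_of K \<Longrightarrow> J = K"
  by (metis inj_on_image_eq_iff inj_pt vertices_hull_of)

lemma polytope_hull_of: "J \<subseteq> I \<Longrightarrow> polytope (hull_of J)"
  using finite_subset[OF _ finite_index] by (intro polytope_convex_hull) simp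

lemma aff_dim_hull_of_less: "J \<subseteq> I \<Longrightarrow> aff_dim (hull_of J) < int (card J)"
  using aff_dim_le_card[of "pt ` J"] finite_subset[OF _ finite_index, of J] inj_on_subset[OF inj_pt, of J]
  by (simp add: aff_dim_convex_hull card_image)

text \<open>A polytope of dimension at most one is a segment and has at most two vertices; together with convex position
this reads off from the number of points whether the dimension is at most one.\<close>

lemma aff_dim_le_1_imp_card:
  assumes "J \<subseteq> I" "aff_dim (hull_of J) \<le> 1"
  shows "card J \<le> 2"
proof (cases "J = {}")
  case False
  have "collinear (hull_of J)" using assms(2) by (simp add: collinear_aff_dim)
  moreover have "compact (hull_of J)" using polytope_hull_of[OF assms(1)] by (rule polytope_imp_compact)
  moreover have "hull_of J \<noteq> {}" using False by simp
  ultimately obtain a b where ab: "hull_of J = closed_segment a b"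
    using compact_convex_collinear_segment[of "hull_of J"] by auto
  have "vertices (closed_segment a b) = {a, b}"
    by (auto simp: vertices_def extreme_point_of_segment)
  then have "card J = card {a, b}" using card_vertices_hull_of[OF assms(1)] ab by simp
  then show ?thesis using card_insert_le_m1[of 2 "{b}" a] by simp
qed simp

lemma aff_dim_eq_1_iff:
  assumes "J \<subseteq> I"
  shows "aff_dim (hull_of J) = 1 \<longleftrightarrow> card J = 2"
proof
  assume "aff_dim (hull_of J) = 1"
  then show "card J = 2"
    using aff_dim_le_1_imp_card[OF assms] aff_dim_hull_of_less[OF assms] by simp
next
  assume "card J = 2"
  then obtain i j where J: "J = {i, j}" "i \<noteq> j" by (auto simp: card_2_iff)
  then have "pt i \<noteq> pt j" using inj_pt assms by (auto simp: inj_on_def)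
  then show "aff_dim (hull_of J) = 1" by (simp add: J aff_dim_convex_hull)
qed

lemma edges_hull: "edges (hull_of I) = hull_of ` {J \<in> range extremal. card J = 2}"
proof -
  have "F edge_of hull_of I \<longleftrightarrow> (F face_of hull_of I \<and> F \<noteq> {}) \<and> aff_dim F = 1" for F
    by (auto simp: edge_of_def)
  then show ?thesis
    unfolding edges_def nonempty_face_iff using aff_dim_eq_1_iff[OF extremal_subset] by auto
qed

lemma aff_dim_extremal_less:
  assumes "extremal w \<noteq> I"
  shows "aff_dim (hull_of (extremal w)) < aff_dim (hull_of I)"
proof (rule face_of_aff_dim_lt)
  show "hull_of (extremal w) face_of hull_of I" using nonempty_face_iff by blast
  show "hull_of (extremal w) \<noteq> hull_of I"
    using hull_of_inject[OF extremal_subset subset_refl] assms by blast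
qed simp

text \<open>In a three-dimensional polytope a proper face with at least three vertices is neither a point nor a segment,
hence two-dimensional.\<close>

lemma facets_hull:
  assumes "aff_dim (hull_of I) = 3"
  shows "facets (hull_of I) = hull_of ` {J \<in> range extremal. 3 \<le> card J \<and> J \<noteq> I}"
proof -
  have "F facet_of hull_of I \<longleftrightarrow> (F face_of hull_of I \<and> F \<noteq> {}) \<and> aff_dim F = 2" for F
    using assms by (auto simp: facet_of_def)
  moreover have "aff_dim (hull_of (extremal w)) = 2 \<longleftrightarrow> 3 \<le> card (extremal w) \<and> extremal w \<noteq> I" for w
  proof
    assume "aff_dim (hull_of (extremal w)) = 2"
    then show "3 \<le> card (extremal w) \<and> extremal w \<noteq> I"
      using aff_dim_hull_of_less[OF extremal_subset, of w] assms by auto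
  next
    assume *: "3 \<le> card (extremal w) \<and> extremal w \<noteq> I"
    then have "aff_dim (hull_of (extremal w)) < 3"
      using aff_dim_extremal_less assms by simp
    moreover have "\<not> aff_dim (hull_of (extremal w)) \<le> 1"
      using aff_dim_le_1_imp_card[OF extremal_subset, of w] * by auto
    ultimately show "aff_dim (hull_of (extremal w)) = 2" by simp
  qed
  ultimately show ?thesis unfolding facets_def nonempty_face_iff by auto
qed

text \<open>A proper face with three vertices forces dimension at least three, since dimension increases strictly along
a chain of faces.\<close>

lemma aff_dim_ge_3:
  assumes "3 \<le> card (extremal w)" "extremal w \<noteq> I"
  shows "3 \<le> aff_dim (hull_of I)"
proof -
  have "aff_dim (hull_of (extremal w)) < aff_dim (hull_of I)"
    using aff_dim_extremal_less assms(2) .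
  moreover have "\<not> aff_dim (hull_of (extremal w)) \<le> 1"
      using aff_dim_le_1_imp_card[OF extremal_subset, of w] assms by auto
  ultimately show ?thesis by simp
qed

end

section \<open>Extreme points of Minkowski sums\<close>

text \<open>If the summand $x$ were inside a segment of $S$, translating that segment by $y$ would put $x + y$
inside a segment of $S + T$.\<close>

lemma extreme_point_of_plus:
  assumes "v extreme_point_of (S + T)" "v = x + y" "x \<in> S" "y \<in> T"
  shows "x extreme_point_of S"
proof -
  have "x \<notin> open_segment a b" if "a \<in> S" "b \<in> S" for a b
  proof
    assume "x \<in> open_segment a b"
    then have "v \<in> open_segment (a + y) (b + y)"
      unfolding assms(2) using open_segment_translation_eq[of y x a b] by (simp add: add.commute)
    then show False using assms that by (auto simp: extreme_point_of_def set_plus_intro)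
  qed
  then show ?thesis using assms(3) by (auto simp: extreme_point_of_def)
qed

text \<open>Two decompositions $x + y = x' + y'$ make this point the midpoint of $x + y'$ and $x' + y$.\<close>

lemma extreme_point_of_plus_unique:
  assumes v: "v extreme_point_of (S + T)" and "v = x + y" "x \<in> S" "y \<in> T" and "v = x' + y'" "x' \<in> S" "y' \<in> T"
  shows "x = x'"
proof (rule ccontr)
  assume "x \<noteq> x'"
  have ne: "x + y' \<noteq> x' + y"
  proof
    assume "x + y' = x' + y"
    then have "x - x' = y - y'" by (simp add: algebra_simps)
    moreover have "x - x' = y' - y" using assms(2,5) by (simp add: algebra_simps)
    ultimately have "(x - x') + (x - x') = (y - y') + (y' - y)" by simp
    then have "2 *\<^sub>R (x - x') = 0" unfolding scaleR_2 by simp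
    then show False using \<open>x \<noteq> x'\<close> by simp
  qed
  have "v + v = (x + y) + (x' + y')" using assms(2,5) by simp
  also have "\<dots> = (x + y') + (x' + y)" by (simp add: algebra_simps)
  finally have "midpoint (x + y') (x' + y) = v" by (simp only: midpoint_eq_iff)
  then have "v \<in> open_segment (x + y') (x' + y)" using ne by auto
  then show False using v assms by (auto simp: extreme_point_of_def set_plus_intro)
qed

lemma extreme_points_of_sum:
  assumes "finite A" "v extreme_point_of (\<Sum>i\<in>A. S i)" "v = (\<Sum>i\<in>A. x i)" "\<And>i. i \<in> A \<Longrightarrow> x i \<in> S i" "j \<in> A"
  shows "x j extreme_point_of S j"
proof -
  have "(\<Sum>i\<in>A. S i) = S j + (\<Sum>i\<in>A - {j}. S i)" "(\<Sum>i\<in>A. x i) = x j + (\<Sum>i\<in>A - {j}. x i)"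
    using assms by (auto simp: sum.remove)
  moreover have "(\<Sum>i\<in>A - {j}. x i) \<in> (\<Sum>i\<in>A - {j}. S i)"
    using assms(1,4) by (subst set_sum_alt) auto
  ultimately show ?thesis using extreme_point_of_plus[of v "S j"] assms by metis
qed

section \<open>Newton polytopes of polynomials with natural coefficients\<close>

text \<open>Polynomials with natural coefficients are closed under sums and products, and in characteristic zero no
cancellation happens among them; so their supports add and multiply exactly.\<close>

definition nat_coeffs :: "('a \<Rightarrow>\<^sub>0 'k::semiring_1) \<Rightarrow> bool" where
  "nat_coeffs F \<longleftrightarrow> (\<exists>f. \<forall>e. Poly_Mapping.lookup F e = of_nat (f e))"

lemma lookup_mult_keys:
  fixes F G :: "'a::monoid_add \<Rightarrow>\<^sub>0 'k::semiring_0"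
  shows "Poly_Mapping.lookup (F * G) e =
    (\<Sum>k\<in>Poly_Mapping.keys F. \<Sum>l\<in>Poly_Mapping.keys G.
      if e = k + l then Poly_Mapping.lookup F k * Poly_Mapping.lookup G l else 0)"
proof -
  have inner: "Sum_any (\<lambda>l. Poly_Mapping.lookup G l when e = k + l)
      = (\<Sum>l\<in>Poly_Mapping.keys G. Poly_Mapping.lookup G l when e = k + l)" for k
    by (rule Sum_any.expand_superset) (auto simp: in_keys_iff)
  have "Poly_Mapping.lookup (F * G) e
      = Sum_any (\<lambda>k. Poly_Mapping.lookup F k * Sum_any (\<lambda>l. Poly_Mapping.lookup G l when e = k + l))"
    by (rule lookup_mult)
  also have "\<dots> = (\<Sum>k\<in>Poly_Mapping.keys F.
      Poly_Mapping.lookup F k * Sum_any (\<lambda>l. Poly_Mapping.lookup G l when e = k + l))"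
    by (rule Sum_any.expand_superset) (auto simp: in_keys_iff)
  finally show ?thesis
    unfolding inner by (simp add: sum_distrib_left when_def if_distrib cong: if_cong)
qed

lemma nat_coeffs_mult:
  fixes F G :: "'a::monoid_add \<Rightarrow>\<^sub>0 'k::{semiring_char_0, comm_semiring_1}"
  assumes "nat_coeffs F" "nat_coeffs G"
  shows "nat_coeffs (F * G)" and "Poly_Mapping.keys (F * G) = Poly_Mapping.keys F + Poly_Mapping.keys G"
proof -
  from assms obtain f g where f: "\<And>e. Poly_Mapping.lookup F e = of_nat (f e)"
    and g: "\<And>e. Poly_Mapping.lookup G e = of_nat (g e)"
    by (auto simp: nat_coeffs_def)
  define h where "h e = (\<Sum>k\<in>Poly_Mapping.keys F. \<Sum>l\<in>Poly_Mapping.keys G. if e = k + l then f k * g l else 0)" for e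
  have h: "Poly_Mapping.lookup (F * G) e = of_nat (h e)" for e
    unfolding lookup_mult_keys h_def of_nat_sum by (intro sum.cong refl) (simp add: f g)
  then show "nat_coeffs (F * G)" by (auto simp: nat_coeffs_def)
  show "Poly_Mapping.keys (F * G) = Poly_Mapping.keys F + Poly_Mapping.keys G"
  proof
    show "Poly_Mapping.keys (F * G) \<subseteq> Poly_Mapping.keys F + Poly_Mapping.keys G"
      using keys_mult[of F G] by (fastforce simp: set_plus_def)
    show "Poly_Mapping.keys F + Poly_Mapping.keys G \<subseteq> Poly_Mapping.keys (F * G)"
    proof
      fix e assume "e \<in> Poly_Mapping.keys F + Poly_Mapping.keys G"
      then obtain k l where kl: "e = k + l" "k \<in> Poly_Mapping.keys F" "l \<in> Poly_Mapping.keys G"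
        by (auto simp: set_plus_def)
      have "f k * g l \<noteq> 0" using kl f[of k] g[of l] by (auto simp: in_keys_iff)
      then have "h e \<noteq> 0" using kl by (auto simp: h_def)
      then show "e \<in> Poly_Mapping.keys (F * G)" by (simp add: in_keys_iff h)
    qed
  qed
qed

lemma nat_coeffs_add:
  fixes F G :: "'a \<Rightarrow>\<^sub>0 'k::{semiring_char_0, comm_semiring_1}"
  assumes "nat_coeffs F" "nat_coeffs G"
  shows "nat_coeffs (F + G)" and "Poly_Mapping.keys (F + G) = Poly_Mapping.keys F \<union> Poly_Mapping.keys G"
proof -
  from assms obtain f g where f: "\<And>e. Poly_Mapping.lookup F e = of_nat (f e)"
    and g: "\<And>e. Poly_Mapping.lookup G e = of_nat (g e)"
    by (auto simp: nat_coeffs_def)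
  then have h: "Poly_Mapping.lookup (F + G) e = of_nat (f e + g e)" for e by (simp add: lookup_add)
  then show "nat_coeffs (F + G)" by (auto simp: nat_coeffs_def simp del: of_nat_add)
  show "Poly_Mapping.keys (F + G) = Poly_Mapping.keys F \<union> Poly_Mapping.keys G"
    by (auto simp: in_keys_iff h f g simp del: of_nat_add)
qed

lemma nat_coeffs_single: "nat_coeffs (Poly_Mapping.single e (of_nat n))"
  unfolding nat_coeffs_def
  by (intro exI[of _ "\<lambda>e'. if e = e' then n else 0"]) (simp add: lookup_single when_def)

lemma nat_coeffs_Var: "nat_coeffs (Var i)"
  using nat_coeffs_single[of "Poly_Mapping.single i 1" 1] by (simp add: Var_def del: One_nat_def)

lemma nat_coeffs_of_nat: "nat_coeffs (of_nat n)"
  using nat_coeffs_single[of 0 n] by (simp flip: single_of_nat)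

lemma nat_coeffs_power:
  fixes F :: "'a::comm_monoid_add \<Rightarrow>\<^sub>0 'k::{semiring_char_0, comm_semiring_1}"
  shows "nat_coeffs F \<Longrightarrow> nat_coeffs (F ^ n)"
proof (induction n)
  case 0
  then show ?case using nat_coeffs_of_nat[of 1] by simp
qed (simp add: nat_coeffs_mult)

lemmas nat_coeffs_intros = nat_coeffs_Var nat_coeffs_of_nat nat_coeffs_power
  nat_coeffs_mult(1) nat_coeffs_add(1)

lemma convex_hull_Un: "convex hull (S \<union> T) = convex hull (convex hull S \<union> convex hull T)"
  by (rule hull_Un) (auto intro: convex_Inter)

lemma exponent_vector_add: "exponent_vector (e + e') = exponent_vector e + exponent_vector e'"
  by (simp add: exponent_vector_def vec_eq_iff lookup_add)

lemma newton_polytope_mult: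
  fixes F G :: "'k::{semiring_char_0, comm_semiring_1} poly6"
  assumes "nat_coeffs F" "nat_coeffs G"
  shows "newton_polytope (F * G) = newton_polytope F + newton_polytope G"
proof -
  have "exponent_vector ` (A + B) = exponent_vector ` A + exponent_vector ` B" for A B
    by (force simp: set_plus_def exponent_vector_add)
  then show ?thesis
    by (simp add: newton_polytope_def nat_coeffs_mult[OF assms] convex_hull_set_plus)
qed

lemma newton_polytope_add:
  fixes F G :: "'k::{semiring_char_0, comm_semiring_1} poly6"
  assumes "nat_coeffs F" "nat_coeffs G"
  shows "newton_polytope (F + G) = convex hull (newton_polytope F \<union> newton_polytope G)"
  unfolding newton_polytope_def nat_coeffs_add[OF assms] image_Un by (rule convex_hull_Un)

lemma newton_polytope_Var:
  "newton_polytope (Var i :: 'k::{semiring_char_0, comm_semiring_1} poly6) = {axis i 1}"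
proof -
  have "exponent_vector (Poly_Mapping.single i 1) = axis i 1"
    by (simp add: exponent_vector_def axis_def vec_eq_iff lookup_single when_def)
  then show ?thesis by (simp add: newton_polytope_def Var_def)
qed

lemma newton_polytope_of_nat:
  "0 < n \<Longrightarrow> newton_polytope (of_nat n :: 'k::{semiring_char_0, comm_semiring_1} poly6) = {0}"
  by (simp add: newton_polytope_def exponent_vector_def vec_eq_iff flip: single_of_nat)

text \<open>For convex $N$ one has $N + nN = (n + 1)N$.\<close>

lemma newton_polytope_power:
  fixes F :: "'k::{semiring_char_0, comm_semiring_1} poly6"
  assumes "nat_coeffs F" "newton_polytope F \<noteq> {}"
  shows "newton_polytope (F ^ n) = (\<lambda>v. real n *\<^sub>R v) ` newton_polytope F"
proof (induction n)
  case 0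
  then show ?case
    using assms(2) newton_polytope_of_nat[of 1, where 'k = 'k] by auto
next
  case (Suc n)
  let ?N = "newton_polytope F"
  have "?N + (\<lambda>v. real n *\<^sub>R v) ` ?N = (\<lambda>v. real (Suc n) *\<^sub>R v) ` ?N"
  proof
    show "?N + (\<lambda>v. real n *\<^sub>R v) ` ?N \<subseteq> (\<lambda>v. real (Suc n) *\<^sub>R v) ` ?N"
    proof
      fix z assume "z \<in> ?N + (\<lambda>v. real n *\<^sub>R v) ` ?N"
      then obtain u v where uv: "u \<in> ?N" "v \<in> ?N" "z = u + real n *\<^sub>R v" by (auto simp: set_plus_def)
      let ?x = "(1 / real (Suc n)) *\<^sub>R u + (real n / real (Suc n)) *\<^sub>R v"
      have "?x \<in> ?N"
        using uv by (intro convexD) (auto simp: newton_polytope_def field_simps)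
      moreover have "z = real (Suc n) *\<^sub>R ?x"
        unfolding uv(3) scaleR_add_right scaleR_scaleR by simp
      ultimately show "z \<in> (\<lambda>v. real (Suc n) *\<^sub>R v) ` ?N" by blast
    qed
    show "(\<lambda>v. real (Suc n) *\<^sub>R v) ` ?N \<subseteq> ?N + (\<lambda>v. real n *\<^sub>R v) ` ?N"
      by (auto simp: set_plus_def algebra_simps)
  qed
  then show ?case using Suc assms by (simp add: newton_polytope_mult nat_coeffs_power)
qed

section \<open>The cuboid and the tetrahedra\<close>

text \<open>All vertices of all summands lie in the image of this affine map of $(x, s, t)$.\<close>

definition homog :: "nat \<Rightarrow> real \<Rightarrow> real \<Rightarrow> real \<Rightarrow> real^var" where
  "homog m x s t = (\<chi> i. case i of X0 \<Rightarrow> x | X1 \<Rightarrow> 1 - x | S0 \<Rightarrow> s | S1 \<Rightarrow> real m - s | T0 \<Rightarrow> t | T1 \<Rightarrow> real m - t)"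

lemma all_var: "(\<forall>i. R i) \<longleftrightarrow> R X0 \<and> R X1 \<and> R S0 \<and> R S1 \<and> R T0 \<and> R T1"
  by (metis var.exhaust)

lemma scaleR_axis: "c *\<^sub>R axis i 1 = axis i c"
  by (simp add: axis_def vec_eq_iff)

lemma newton_polytope_segment:
  "newton_polytope ((Var i + Var j) ^ n :: 'k::{semiring_char_0, comm_semiring_1} poly6)
    = convex hull {axis i (real n), axis j (real n)}"
proof -
  have "newton_polytope (Var i + Var j :: 'k poly6) = convex hull {axis i 1, axis j 1}"
    by (simp add: newton_polytope_add nat_coeffs_intros newton_polytope_Var insert_commute)
  then show ?thesis
    by (simp add: newton_polytope_power nat_coeffs_intros convex_hull_scaling[symmetric] scaleR_axis)
qed

lemma newton_polytope_Var_power: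
  "newton_polytope (Var i ^ n :: 'k::{semiring_char_0, comm_semiring_1} poly6) = {axis i (real n)}"
  by (simp add: newton_polytope_power nat_coeffs_intros newton_polytope_Var scaleR_axis)

lemma homog_eq_axis:
  "homog m x s t = axis X0 x + axis X1 (1 - x) + (axis S0 s + axis S1 (real m - s))
    + (axis T0 t + axis T1 (real m - t))"
  by (simp add: homog_def vec_eq_iff all_var axis_def)

lemma axis_zero: "axis i 0 = 0"
  by (simp add: axis_def vec_eq_iff)

lemma newton_polytope_Q:
  "newton_polytope (Q m :: 'k::{semiring_char_0, comm_semiring_1} poly6)
    = convex hull ((\<lambda>(x, s, t). homog m x s t) ` ({0, 1} \<times> {0, real m} \<times> {0, real m}))"
proof -
  have "newton_polytope (Q m :: 'k poly6) = convex hull {axis X0 1, axis X1 1}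
      + convex hull {axis S0 (real m), axis S1 (real m)} + convex hull {axis T0 (real m), axis T1 (real m)}"
    using newton_polytope_segment[of X0 X1 1, where 'k = 'k]
    by (simp add: Q_def newton_polytope_mult newton_polytope_segment nat_coeffs_intros)
  also have "\<dots> = convex hull ({axis X0 1, axis X1 1} + {axis S0 (real m), axis S1 (real m)}
      + {axis T0 (real m), axis T1 (real m)})"
    by (simp only: convex_hull_set_plus)
  also have "{axis X0 1, axis X1 1} + {axis S0 (real m), axis S1 (real m)} + {axis T0 (real m), axis T1 (real m)}
      = (\<lambda>(x, s, t). homog m x s t) ` ({0, 1} \<times> {0, real m} \<times> {0, real m})"
    by (auto simp: set_plus_def homog_eq_axis axis_zero)
  finally show ?thesis .
qed

lemma newton_polytope_P:
  assumes "l \<le> m"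
  shows "newton_polytope (P m l :: 'k::{semiring_char_0, comm_semiring_1} poly6)
    = convex hull {homog m 1 (real l) (real m), homog m 1 (real l) 0, homog m 0 (real m) (real l), homog m 0 0 (real l)}"
proof -
  have bin: "0 < m choose l" using assms by simp
  have "newton_polytope (P m l :: 'k poly6) = convex hull
     (({axis X0 1} + {axis S0 (real l)} + {axis S1 (real (m - l))} + convex hull {axis T0 (real m), axis T1 (real m)})
     \<union> ({axis X1 1} + {axis T0 (real l)} + {axis T1 (real (m - l))} + convex hull {axis S0 (real m), axis S1 (real m)}))"
    unfolding P_def using newton_polytope_of_nat[OF bin, where 'k = 'k]
    by (simp add: newton_polytope_mult newton_polytope_add newton_polytope_segment newton_polytope_Var
        newton_polytope_Var_power nat_coeffs_intros)
  also have "{axis X0 1} + {axis S0 (real l)} + {axis S1 (real (m - l))}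
        + convex hull {axis T0 (real m), axis T1 (real m)}
      = convex hull {homog m 1 (real l) (real m), homog m 1 (real l) 0}"
  proof -
    have "{axis X0 1} + {axis S0 (real l)} + {axis S1 (real (m - l))} + {axis T0 (real m), axis T1 (real m)}
        = {homog m 1 (real l) (real m), homog m 1 (real l) 0}"
      using assms by (auto simp: set_plus_def homog_eq_axis axis_zero of_nat_diff ac_simps)
    then show ?thesis by (metis convex_hull_set_plus convex_hull_singleton)
  qed
  also have "{axis X1 1} + {axis T0 (real l)} + {axis T1 (real (m - l))}
        + convex hull {axis S0 (real m), axis S1 (real m)}
      = convex hull {homog m 0 (real m) (real l), homog m 0 0 (real l)}"
  proof -
    have "{axis X1 1} + {axis T0 (real l)} + {axis T1 (real (m - l))} + {axis S0 (real m), axis S1 (real m)}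
        = {homog m 0 (real m) (real l), homog m 0 0 (real l)}"
      using assms by (auto simp: set_plus_def homog_eq_axis axis_zero of_nat_diff ac_simps)
    then show ?thesis by (metis convex_hull_set_plus convex_hull_singleton)
  qed
  finally show ?thesis by (simp add: insert_commute flip: convex_hull_Un)
qed

section \<open>Labels of the vertices and their normal cones\<close>

text \<open>A node $(\alpha, \beta, \gamma, r)$ labels a vertex of the Minkowski sum. The booleans are the signs of the slopes
$a, b, c$ (with \<open>True\<close> for positive) of the functionals that are maximal there. If \<open>\<alpha>\<close> holds, then $r + 1$
tetrahedra contribute an end of their upper edge; otherwise $r + 1$ tetrahedra contribute an end of their lower edge.
At least one does: for positive $a$ the tetrahedron with $l = m$ (if $b > 0$) or $l = 0$ (if $b < 0$) prefers its
upper edge, and negative $a$ is symmetric to this.\<close>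

type_synonym node = "bool \<times> bool \<times> bool \<times> nat"

text \<open>Weak sign conditions, so that both signs hold at zero: normal cones are closed.\<close>

definition has_sign :: "bool \<Rightarrow> real \<Rightarrow> bool" where
  "has_sign p x \<longleftrightarrow> (if p then 0 \<le> x else x \<le> 0)"

text \<open>The last or the first $r + 1$ numbers of $\{0, \dots, m\}$, in a form without subtraction.\<close>

definition selects :: "nat \<Rightarrow> nat \<Rightarrow> bool \<Rightarrow> nat \<Rightarrow> bool" where
  "selects m r p l \<longleftrightarrow> (if p then m \<le> l + r else l \<le> r)"

text \<open>Whether the node takes its summand in the $l$-th tetrahedron from the upper edge.\<close>

fun upper :: "nat \<Rightarrow> node \<Rightarrow> nat \<Rightarrow> bool" where
  "upper m (\<alpha>, \<beta>, \<gamma>, r) l \<longleftrightarrow> (if \<alpha> then selects m r \<beta> l else \<not> selects m r \<gamma> l)"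

text \<open>The maximum of the functional with slopes $a, b, c$ on the upper edge of the $l$-th tetrahedron minus its maximum
on the lower edge (see \<open>gain_eq\<close>), arranged to show that it is affine in $l$ and how it behaves under the
two symmetries.\<close>

definition gain :: "nat \<Rightarrow> nat \<Rightarrow> real \<Rightarrow> real \<Rightarrow> real \<Rightarrow> real" where
  "gain m l a b c = a - real (m - l) * (max b 0 - max c 0) - real l * (max (- b) 0 - max (- c) 0)"

fun in_normal_cone :: "nat \<Rightarrow> real \<Rightarrow> real \<Rightarrow> real \<Rightarrow> node \<Rightarrow> bool" where
  "in_normal_cone m a b c (\<alpha>, \<beta>, \<gamma>, r) \<longleftrightarrow>
     has_sign \<alpha> a \<and> has_sign \<beta> b \<and> has_sign \<gamma> c \<and> (\<forall>l\<le>m. has_sign (upper m (\<alpha>, \<beta>, \<gamma>, r) l) (gain m l a b c))"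

definition nodes :: "nat \<Rightarrow> node set" where
  "nodes m = UNIV \<times> UNIV \<times> UNIV \<times> {..m}"

definition peak :: "nat \<Rightarrow> real \<Rightarrow> real \<Rightarrow> real \<Rightarrow> node set" where
  "peak m a b c = {i \<in> nodes m. in_normal_cone m a b c i}"

text \<open>These are the actions on labels of two symmetries of the summands: $(x, s, t) \mapsto (1 - x, t, s)$ fixes each
tetrahedron and exchanges its two edges, while $(x, s, t) \mapsto (x, m - s, m - t)$ maps the $l$-th tetrahedron to
the $(m - l)$-th. On slopes they act by $(a, b, c) \mapsto (-a, c, b)$ and $(a, b, c) \mapsto (a, -b, -c)$.\<close>

fun swap :: "node \<Rightarrow> node" where "swap (\<alpha>, \<beta>, \<gamma>, r) = (\<not> \<alpha>, \<gamma>, \<beta>, r)"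
fun flip :: "node \<Rightarrow> node" where "flip (\<alpha>, \<beta>, \<gamma>, r) = (\<alpha>, \<not> \<beta>, \<not> \<gamma>, r)"

lemma swap_swap [simp]: "swap (swap i) = i" by (cases i) simp
lemma flip_flip [simp]: "flip (flip i) = i" by (cases i) simp

lemma has_sign_uminus: "has_sign p (- x) = has_sign (\<not> p) x" by (simp add: has_sign_def)

lemma cone_swap: "in_normal_cone m (- a) c b (swap i) = in_normal_cone m a b c i"
proof -
  have "gain m l (- a) c b = - gain m l a b c" for l by (simp add: gain_def algebra_simps)
  then show ?thesis by (cases i) (auto simp: has_sign_uminus)
qed

lemma cone_flip: "in_normal_cone m a (- b) (- c) (flip i) = in_normal_cone m a b c i"
proof -
  obtain \<alpha> \<beta> \<gamma> r where i: "i = (\<alpha>, \<beta>, \<gamma>, r)" by (cases i)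
  have gain: "gain m l a (- b) (- c) = gain m (m - l) a b c" if "l \<le> m" for l
    using that by (simp add: gain_def algebra_simps)
  have up: "upper m (flip i) l = upper m i (m - l)" if "l \<le> m" for l
    using that by (auto simp: i selects_def)
  have "(\<forall>l\<le>m. has_sign (upper m (flip i) l) (gain m l a (- b) (- c)))
      = (\<forall>l\<le>m. has_sign (upper m i l) (gain m l a b c))" (is "?L = ?R")
  proof
    assume ?L
    show ?R
    proof (intro allI impI)
      fix l assume "l \<le> m"
      then show "has_sign (upper m i l) (gain m l a b c)"
        using \<open>?L\<close>[rule_format, of "m - l"] gain[of "m - l"] up[of "m - l"] by simp
    qed
  qed (simp add: gain up)
  then show ?thesis by (auto simp: i has_sign_uminus)
qed

text \<open>Of the $m + 1$ sign conditions on the gain only the two next to the switch from lower to upper edge matter: the gain is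
monotone in $l$, and where it decreases ($b < c$) the condition $a \ge 0$ leaves only $r = m$.\<close>

lemma cone_plus_plus:
  assumes "r \<le> m"
  shows "in_normal_cone m a b c (True, True, True, r) \<longleftrightarrow>
    0 \<le> a \<and> 0 \<le> b \<and> 0 \<le> c \<and> real r * (b - c) \<le> a \<and> (r < m \<longrightarrow> a \<le> real (Suc r) * (b - c))"
    (is "?L \<longleftrightarrow> ?R")
proof
  assume L: ?L
  then have s: "0 \<le> a" "0 \<le> b" "0 \<le> c" by (auto simp: has_sign_def)
  have *: "has_sign (m \<le> l + r) (gain m l a b c)" if "l \<le> m" for l
    using L that by (simp add: selects_def)
  have "a \<le> real (Suc r) * (b - c)" if "r < m"
  proof -
    have "\<not> m \<le> m - Suc r + r" "m - (m - Suc r) = Suc r" using that by auto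
    then show ?thesis using *[of "m - Suc r"] s by (simp add: has_sign_def gain_def)
  qed
  then show ?R using s assms *[of "m - r"] by (auto simp: has_sign_def gain_def)
next
  assume R: ?R
  have "has_sign (m \<le> l + r) (gain m l a b c)" if "l \<le> m" for l
  proof (cases "m \<le> l + r")
    case True
    then have k: "real (m - l) \<le> real r" by linarith
    have "real (m - l) * (b - c) \<le> a"
    proof (cases "b \<le> c")
      case True
      then show ?thesis using R by (smt (verit) mult_nonneg_nonpos of_nat_0_le_iff)
    next
      case False
      then show ?thesis using R mult_right_mono[OF k, of "b - c"] by linarith
    qed
    then show ?thesis using R True by (simp add: has_sign_def gain_def)
  next
    case False
    then have k: "real (Suc r) \<le> real (m - l)" and "r < m" by linarith+
    then have "0 \<le> real (Suc r) * (b - c)" and a: "a \<le> real (Suc r) * (b - c)" using R by auto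
    then have "0 \<le> b - c" by (simp add: zero_le_mult_iff)
    then show ?thesis
      using R a False mult_right_mono[OF k, of "b - c"] by (simp add: has_sign_def gain_def)
  qed
  then show ?L using R by (simp add: has_sign_def selects_def)
qed

text \<open>With $b$ and $c$ of opposite signs the gain is monotone in $l$ throughout.\<close>

lemma cone_plus_minus:
  assumes "r \<le> m"
  shows "in_normal_cone m a b c (True, True, False, r) \<longleftrightarrow>
    0 \<le> a \<and> 0 \<le> b \<and> c \<le> 0 \<and> real r * b + (real m - real r) * c \<le> a
      \<and> (r < m \<longrightarrow> a \<le> real (Suc r) * b + (real m - real (Suc r)) * c)"
    (is "?L \<longleftrightarrow> ?R")
proof
  assume L: ?L
  then have s: "0 \<le> a" "0 \<le> b" "c \<le> 0" by (auto simp: has_sign_def)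
  have *: "has_sign (m \<le> l + r) (gain m l a b c)" if "l \<le> m" for l
    using L that by (simp add: selects_def)
  have "a \<le> real (Suc r) * b + (real m - real (Suc r)) * c" if "r < m"
  proof -
    have "\<not> m \<le> m - Suc r + r" "m - (m - Suc r) = Suc r" using that by auto
    then show ?thesis using *[of "m - Suc r"] s that
      by (simp add: has_sign_def gain_def of_nat_diff algebra_simps)
  qed
  then show ?R using s assms *[of "m - r"] by (auto simp: has_sign_def gain_def of_nat_diff algebra_simps)
next
  assume R: ?R
  have mono: "real k * b + (real m - real k) * c \<le> real k' * b + (real m - real k') * c"
    if "k \<le> k'" for k k'
  proof -
    have "0 \<le> (real k' - real k) * (b - c)" using that R by simp
    then show ?thesis by (simp add: algebra_simps)
  qed
  have "has_sign (m \<le> l + r) (gain m l a b c)" if "l \<le> m" for l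
  proof -
    have p: "gain m l a b c = a - (real (m - l) * b + (real m - real (m - l)) * c)"
    proof -
      have "max b 0 = b" "max c 0 = 0" "max (- b) 0 = 0" "max (- c) 0 = - c" using R by auto
      then show ?thesis using that by (simp add: gain_def algebra_simps of_nat_diff)
    qed
    show ?thesis
    proof (cases "m \<le> l + r")
      case True
      then have "m - l \<le> r" by simp
      from mono[OF this] show ?thesis using R True p by (simp add: has_sign_def)
    next
      case False
      then have "Suc r \<le> m - l" "r < m" by simp_all
      from mono[OF this(1)] this(2) show ?thesis using R False p by (simp add: has_sign_def)
    qed
  qed
  then show ?L using R by (simp add: has_sign_def selects_def)
qed

text \<open>The symmetries carry the remaining six sign patterns to the two just treated.\<close>

lemma cone_reduce:
  "in_normal_cone m a b c (False, \<beta>, \<gamma>, r) \<longleftrightarrow> in_normal_cone m (- a) c b (True, \<gamma>, \<beta>, r)"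
  "in_normal_cone m a b c (True, False, \<gamma>, r) \<longleftrightarrow> in_normal_cone m a (- b) (- c) (True, True, \<not> \<gamma>, r)"
  using cone_swap[of m a c b "(False, \<beta>, \<gamma>, r)"] cone_flip[of m a b c "(True, False, \<gamma>, r)"]
  by (simp_all del: in_normal_cone.simps)

lemma involution_image_eq:
  assumes "\<And>i. f (f i) = i" "\<And>i. i \<in> A \<longleftrightarrow> f i \<in> B"
  shows "A = f ` B"
  using assms by (auto intro!: rev_image_eqI)

lemma peak_swap: "peak m (- a) c b = swap ` peak m a b c"
proof -
  have "i \<in> peak m (- a) c b \<longleftrightarrow> swap i \<in> peak m a b c" for i
    using cone_swap[of m a c b "swap i"] by (cases i) (auto simp: peak_def nodes_def simp del: in_normal_cone.simps)
  then show ?thesis by (rule involution_image_eq[rotated]) simp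
qed

lemma peak_flip: "peak m a (- b) (- c) = flip ` peak m a b c"
proof -
  have "i \<in> peak m a (- b) (- c) \<longleftrightarrow> flip i \<in> peak m a b c" for i
    using cone_flip[of m a b c "flip i"] by (cases i) (auto simp: peak_def nodes_def simp del: in_normal_cone.simps)
  then show ?thesis by (rule involution_image_eq[rotated]) simp
qed

section \<open>The peaks sector by sector\<close>

text \<open>The positions $r$ that are compatible with the value $x$ when $f$ lists the thresholds between consecutive normal cones;
the last cone is unbounded above.\<close>

definition window :: "nat \<Rightarrow> (nat \<Rightarrow> real) \<Rightarrow> real \<Rightarrow> nat set" where
  "window m f x = {r. r \<le> m \<and> f r \<le> x \<and> (r < m \<longrightarrow> x \<le> f (Suc r))}"

lemma peak_eqI:
  assumes "\<And>r. r \<le> m \<Longrightarrow> in_normal_cone m a b c (True, True, True, r) \<longleftrightarrow> (True, True, True, r) \<in> W"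
    and "\<And>r. r \<le> m \<Longrightarrow> in_normal_cone m a b c (True, True, False, r) \<longleftrightarrow> (True, True, False, r) \<in> W"
    and "\<And>r. r \<le> m \<Longrightarrow> in_normal_cone m a b c (True, False, True, r) \<longleftrightarrow> (True, False, True, r) \<in> W"
    and "\<And>r. r \<le> m \<Longrightarrow> in_normal_cone m a b c (True, False, False, r) \<longleftrightarrow> (True, False, False, r) \<in> W"
    and "\<And>r. r \<le> m \<Longrightarrow> in_normal_cone m a b c (False, True, True, r) \<longleftrightarrow> (False, True, True, r) \<in> W"
    and "\<And>r. r \<le> m \<Longrightarrow> in_normal_cone m a b c (False, True, False, r) \<longleftrightarrow> (False, True, False, r) \<in> W"
    and "\<And>r. r \<le> m \<Longrightarrow> in_normal_cone m a b c (False, False, True, r) \<longleftrightarrow> (False, False, True, r) \<in> W"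
    and "\<And>r. r \<le> m \<Longrightarrow> in_normal_cone m a b c (False, False, False, r) \<longleftrightarrow> (False, False, False, r) \<in> W"
    and "W \<subseteq> nodes m"
  shows "peak m a b c = W"
proof (rule set_eqI)
  fix i :: node
  obtain \<alpha> \<beta> \<gamma> r where i: "i = (\<alpha>, \<beta>, \<gamma>, r)" by (cases i)
  have r: "i \<in> nodes m \<longleftrightarrow> r \<le> m" by (simp add: i nodes_def)
  show "i \<in> peak m a b c \<longleftrightarrow> i \<in> W"
  proof (cases "r \<le> m")
    case True
    have "in_normal_cone m a b c i \<longleftrightarrow> i \<in> W"
      unfolding i by (cases \<alpha>; cases \<beta>; cases \<gamma>) (simp_all only: assms(1-8)[OF True])
    then show ?thesis using True r by (simp add: peak_def)
  qed (use r assms(9) in \<open>auto simp: peak_def\<close>)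
qed

lemma peak_zero: "peak m 0 0 0 = nodes m"
  by (rule peak_eqI; simp add: cone_reduce cone_plus_plus cone_plus_minus nodes_def del: in_normal_cone.simps)

lemma peak_pole: "0 < a \<Longrightarrow> peak m a 0 0 = {True} \<times> UNIV \<times> UNIV \<times> {m}"
  by (rule peak_eqI; auto simp add: cone_reduce cone_plus_plus cone_plus_minus nodes_def simp del: in_normal_cone.simps)

lemma peak_wall_pos:
  assumes "0 < a" "0 < c"
  shows "peak m a 0 c = {True} \<times> UNIV \<times> {True} \<times> {m}"
proof -
  have "0 < (1 + real r) * c" for r using assms by simp
  then have 1: "\<not> a \<le> - ((1 + real r) * c)" for r using assms by (smt (verit))
  have "0 \<le> (real m - (1 + real r)) * c" if "r < m" for r using assms that by simp
  then have 2: "\<not> a \<le> - ((real m - (1 + real r)) * c)" if "r < m" for r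
    using that assms by (smt (verit))
  have 3: "- (real m * c) \<le> a" using assms by (smt (verit) mult_nonneg_nonneg of_nat_0_le_iff)
  show ?thesis
    by (rule peak_eqI; use assms 1 2 3 in \<open>auto simp: cone_reduce cone_plus_plus cone_plus_minus nodes_def window_def simp del: in_normal_cone.simps\<close>)
qed

lemma peak_wall_neg: "a < 0 \<Longrightarrow> 0 < c \<Longrightarrow>
   peak m a 0 c = {False} \<times> UNIV \<times> {True} \<times> window m (\<lambda>r. real r * c) (- a)"
  by (rule peak_eqI; auto simp add: cone_reduce cone_plus_plus cone_plus_minus nodes_def window_def simp del: in_normal_cone.simps)
lemma peak_wall_zero:
  assumes "0 < m" "0 < c"
  shows "peak m 0 0 c = {(True, True, True, m), (True, False, True, m), (True, False, True, m - 1),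
     (False, True, True, 0), (False, False, True, 0)}"
  by (rule peak_eqI; use assms in \<open>auto simp: cone_reduce cone_plus_plus cone_plus_minus nodes_def mult_le_0_iff window_def simp del: in_normal_cone.simps\<close>)

text \<open>Inside the sector $0 < c < b$ of the $(b, c)$-plane the thresholds for positive $a$ increase with $r$; those for
negative $a$ would decrease, which leaves only the last cone there.\<close>

lemma peak_quadrant:
  assumes "0 < c" "c < b"
  shows "peak m a b c =
   (if 0 \<le> a then {True} \<times> {True} \<times> {True} \<times> window m (\<lambda>r. real r * (b - c)) a else {})
   \<union> (if a \<le> 0 then {(False, True, True, m)} else {})"
proof -
  have neg: "(1 + real r) * (c - b) < 0" for r using assms by (simp add: mult_pos_neg)
  have 1: "\<not> - a \<le> (1 + real r) * (c - b)" if "a \<le> 0" for r using neg[of r] that by linarith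
  have 2: "real m * (c - b) \<le> - a" if "a \<le> 0"
    using assms that by (smt (verit) mult_nonneg_nonpos of_nat_0_le_iff)
  show ?thesis
    by (rule peak_eqI; use assms 1 2 neg in \<open>auto simp: cone_reduce cone_plus_plus cone_plus_minus nodes_def window_def simp del: in_normal_cone.simps\<close>)
qed

lemma peak_diagonal: "0 < b \<Longrightarrow> peak m a b b =
   (if a = 0 then {(\<alpha>, True, True, r) |\<alpha> r. r \<le> m} else {(0 < a, True, True, m)})"
  by (rule peak_eqI; auto simp add: cone_reduce cone_plus_plus cone_plus_minus nodes_def window_def simp del: in_normal_cone.simps)
lemma peak_mixed: "c < 0 \<Longrightarrow> 0 < b \<Longrightarrow> peak m a b c =
   (if 0 \<le> a then {True} \<times> {True} \<times> {False} \<times> window m (\<lambda>r. real r * b + (real m - real r) * c) a else {})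
   \<union> (if a \<le> 0 then {False} \<times> {True} \<times> {False} \<times> window m (\<lambda>r. - (real r * c) - (real m - real r) * b) (- a) else {})"
  by (rule peak_eqI; auto simp add: cone_reduce cone_plus_plus cone_plus_minus nodes_def window_def simp del: in_normal_cone.simps)

lemma window_tie:
  assumes "strict_mono f" "r < m"
  shows "window m f (f (Suc r)) = {r, Suc r}"
  using assms by (auto simp: window_def strict_mono_less_eq)

lemma window_open:
  assumes "strict_mono f" "r \<le> m" "f r < x" "r < m \<Longrightarrow> x < f (Suc r)"
  shows "window m f x = {r}"
proof -
  have "s = r" if "s \<in> window m f x" for s
  proof (rule ccontr)
    assume "s \<noteq> r"
    then consider "s < r" | "r < s" by linarith
    then show False
    proof cases
      case 1
      then have "x \<le> f (Suc s)" "f (Suc s) \<le> f r"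
        using that assms by (auto simp: window_def strict_mono_less_eq)
      then show False using assms by simp
    next
      case 2
      then have "f s \<le> x" "f (Suc r) \<le> f s" "r < m"
        using that assms by (auto simp: window_def strict_mono_less_eq)
      then show False using assms(4) by simp
    qed
  qed
  moreover have "r \<in> window m f x" using assms by (auto simp: window_def)
  ultimately show ?thesis by blast
qed

lemma window_low:
  assumes "strict_mono f" "0 < m" "x = f 0"
  shows "window m f x = {0}"
  using assms by (auto simp: window_def strict_mono_less_eq)

text \<open>Strictly monotone thresholds allow one or two consecutive positions. This is where the edges and quadrilaterals that join
consecutive values of $r$ come from.\<close>

lemma window_cases:
  assumes "strict_mono f" "f 0 < x"
  obtains (tie) r where "r < m" "x = f (Suc r)" "window m f x = {r, Suc r}"
        | (gap) r where "r \<le> m" "f r < x" "r < m \<Longrightarrow> x < f (Suc r)" "window m f x = {r}"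
proof -
  define r where "r = (GREATEST r. r \<le> m \<and> f r < x)"
  have r: "r \<le> m \<and> f r < x"
    unfolding r_def by (rule GreatestI_nat[of _ 0 m]) (use assms in auto)
  have "x \<le> f (Suc r)" if "r < m"
  proof (rule ccontr)
    assume "\<not> ?thesis"
    then have "Suc r \<le> r"
      unfolding r_def by (intro Greatest_le_nat[of _ _ m]) (use that r_def in auto)
    then show False by simp
  qed
  then consider "r < m" "x = f (Suc r)" | "r < m \<Longrightarrow> x < f (Suc r)" by force
  then show thesis
    using window_tie[OF assms(1), of r m] window_open[OF assms(1), of r m x] r tie gap by cases auto
qed

section \<open>The lists of edges and facets\<close>

text \<open>Walls of the normal fan. Steps along a chain of nodes with equal signs are crossed at a threshold of $a$; rungs and caps
lie over the axes of the $(b, c)$-plane; the last two families lie in the plane $a = 0$. The union of two equal-sign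
chains over \<open>\<beta> = \<gamma>\<close> is closed up to a cycle of $2(m + 1)$ nodes by \<open>closing\<close>, whereas chains over
\<open>\<beta> \<noteq> \<gamma>\<close> run against each other and are joined position by position by \<open>crossing\<close>.\<close>

inductive_set edge_sets :: "nat \<Rightarrow> node set set" for m where
  chain_step: "r < m \<Longrightarrow> {(\<alpha>, \<beta>, \<gamma>, r), (\<alpha>, \<beta>, \<gamma>, Suc r)} \<in> edge_sets m"
| upper_rung: "r \<le> m \<Longrightarrow> {(True, \<beta>, True, r), (True, \<beta>, False, r)} \<in> edge_sets m"
| lower_rung: "r \<le> m \<Longrightarrow> {(False, True, \<gamma>, r), (False, False, \<gamma>, r)} \<in> edge_sets m"
| upper_cap: "{(True, True, \<gamma>, m), (True, False, \<gamma>, m)} \<in> edge_sets m"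
| lower_cap: "{(False, \<beta>, True, m), (False, \<beta>, False, m)} \<in> edge_sets m"
| closing: "{(\<alpha>, \<beta>, \<beta>, 0), (\<not> \<alpha>, \<beta>, \<beta>, m)} \<in> edge_sets m"
| crossing: "r < m \<Longrightarrow> {(True, \<beta>, \<not> \<beta>, r), (False, \<beta>, \<not> \<beta>, m - 1 - r)} \<in> edge_sets m"

text \<open>The facets, with an outer normal $(a, b, c)$ up to symmetry: \<open>cap\<close> has $(1, 0, 0)$ and
\<open>belt\<close> has $(0, 1, 1)$; \<open>panel\<close> has $(-k, 0, 1)$ with $k > 0$ and \<open>pentagon\<close> the limiting case
$(0, 0, 1)$; \<open>bridge\<close> has $(0, k, -(m - k))$ with $0 < k < m$.\<close>

definition cap :: "nat \<Rightarrow> bool \<Rightarrow> node set" where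
  "cap m \<alpha> = {\<alpha>} \<times> UNIV \<times> UNIV \<times> {m}"
definition belt :: "nat \<Rightarrow> bool \<Rightarrow> node set" where
  "belt m \<beta> = {(\<alpha>, \<beta>, \<beta>, r) |\<alpha> r. r \<le> m}"
definition panel :: "bool \<Rightarrow> bool \<Rightarrow> nat \<Rightarrow> node set" where
  "panel \<alpha> p r = (if \<alpha> then {True} \<times> {p} \<times> UNIV \<times> {r, Suc r} else {False} \<times> UNIV \<times> {p} \<times> {r, Suc r})"
definition bridge :: "nat \<Rightarrow> bool \<Rightarrow> nat \<Rightarrow> node set" where
  "bridge m p r = {(True, p, \<not> p, r), (True, p, \<not> p, Suc r),
     (False, p, \<not> p, m - 1 - r), (False, p, \<not> p, m - 2 - r)}"
definition pentagon :: "nat \<Rightarrow> bool \<Rightarrow> bool \<Rightarrow> node set" where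
  "pentagon m \<alpha> p = (if \<alpha>
     then {(True, p, p, m), (True, \<not> p, p, m), (True, \<not> p, p, m - 1), (False, p, p, 0), (False, \<not> p, p, 0)}
     else {(False, p, p, m), (False, p, \<not> p, m), (False, p, \<not> p, m - 1), (True, p, p, 0), (True, p, \<not> p, 0)})"

inductive_set facet_sets :: "nat \<Rightarrow> node set set" for m where
  caps: "cap m \<alpha> \<in> facet_sets m"
| belts: "belt m \<beta> \<in> facet_sets m"
| panels: "r < m \<Longrightarrow> panel \<alpha> p r \<in> facet_sets m"
| bridges: "r < m - 1 \<Longrightarrow> bridge m p r \<in> facet_sets m"
| pentagons: "pentagon m \<alpha> p \<in> facet_sets m"

lemma swap_image: "swap ` W = swap -` W"
  by (rule sym, rule involution_image_eq) simp_all

lemma flip_image: "flip ` W = flip -` W"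
  by (rule sym, rule involution_image_eq) simp_all

lemma swap_shapes:
  "swap ` cap m \<alpha> = cap m (\<not> \<alpha>)" "swap ` belt m \<beta> = belt m \<beta>"
  "swap ` panel \<alpha> p r = panel (\<not> \<alpha>) p r"
  "r < m - 1 \<Longrightarrow> swap ` bridge m p r = bridge m (\<not> p) (m - 2 - r)"
  "swap ` pentagon m \<alpha> p = pentagon m (\<not> \<alpha>) p"
proof -
  show "swap ` cap m \<alpha> = cap m (\<not> \<alpha>)" "swap ` belt m \<beta> = belt m \<beta>"
    "swap ` panel \<alpha> p r = panel (\<not> \<alpha>) p r"
    unfolding swap_image by (auto simp: cap_def belt_def panel_def)
  show "swap ` pentagon m \<alpha> p = pentagon m (\<not> \<alpha>) p" by (auto simp: pentagon_def)
  assume "r < m - 1"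
  then have "m - 1 - (m - 2 - r) = Suc r" "m - 2 - (m - 2 - r) = r" "Suc (m - 2 - r) = m - 1 - r" by auto
  then show "swap ` bridge m p r = bridge m (\<not> p) (m - 2 - r)"
    unfolding bridge_def by (auto simp: insert_commute)
qed

lemma flip_shapes:
  "flip ` cap m \<alpha> = cap m \<alpha>" "flip ` belt m \<beta> = belt m (\<not> \<beta>)"
  "flip ` panel \<alpha> p r = panel \<alpha> (\<not> p) r"
  "flip ` bridge m p r = bridge m (\<not> p) r"
  "flip ` pentagon m \<alpha> p = pentagon m \<alpha> (\<not> p)"
proof -
  show "flip ` cap m \<alpha> = cap m \<alpha>" "flip ` belt m \<beta> = belt m (\<not> \<beta>)"
    "flip ` panel \<alpha> p r = panel \<alpha> (\<not> p) r"
    unfolding flip_image by (auto simp: cap_def belt_def panel_def)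
  show "flip ` pentagon m \<alpha> p = pentagon m \<alpha> (\<not> p)" "flip ` bridge m p r = bridge m (\<not> p) r"
    by (auto simp: pentagon_def bridge_def)
qed

lemma swap_facet_sets: "W \<in> facet_sets m \<Longrightarrow> swap ` W \<in> facet_sets m"
  by (elim facet_sets.cases) (auto simp: swap_shapes intro!: facet_sets.intros)

lemma flip_facet_sets: "W \<in> facet_sets m \<Longrightarrow> flip ` W \<in> facet_sets m"
  by (elim facet_sets.cases) (auto simp: flip_shapes intro!: facet_sets.intros)

lemma swap_edge_sets:
  assumes "W \<in> edge_sets m"
  shows "swap ` W \<in> edge_sets m"
  using assms
proof (cases rule: edge_sets.cases)
  case (closing \<alpha> \<beta>)
  then show ?thesis using edge_sets.closing[of "\<not> \<alpha>" \<beta> m] by simp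
next
  case (crossing r \<beta>)
  then have "m - 1 - (m - 1 - r) = r" by simp
  with crossing show ?thesis using edge_sets.crossing[of "m - 1 - r" m "\<not> \<beta>"] by (simp add: insert_commute)
qed (auto intro: edge_sets.intros)

lemma flip_edge_sets:
  assumes "W \<in> edge_sets m"
  shows "flip ` W \<in> edge_sets m"
  using assms
proof (cases rule: edge_sets.cases)
  case (upper_rung r \<beta>)
  then show ?thesis using edge_sets.upper_rung[of r m "\<not> \<beta>"] by (simp add: insert_commute)
next
  case (lower_rung r \<beta>)
  then show ?thesis using edge_sets.lower_rung[of r m "\<not> \<beta>"] by (simp add: insert_commute)
next
  case (upper_cap \<beta>)
  then show ?thesis using edge_sets.upper_cap[of "\<not> \<beta>" m] by (simp add: insert_commute)
next
  case (lower_cap \<beta>)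
  then show ?thesis using edge_sets.lower_cap[of "\<not> \<beta>" m] by (simp add: insert_commute)
next
  case (crossing r \<beta>)
  then show ?thesis using edge_sets.crossing[of r m "\<not> \<beta>"] by (simp add: insert_commute)
qed (auto intro: edge_sets.intros)

section \<open>Every peak is in the lists\<close>

definition cells :: "nat \<Rightarrow> node set set" where
  "cells m = {nodes m} \<union> facet_sets m \<union> edge_sets m \<union> (\<lambda>i. {i}) ` nodes m"

lemma swap_nodes: "swap ` nodes m = nodes m"
  using peak_swap[of m 0 0 0] by (simp add: peak_zero)
lemma flip_nodes: "flip ` nodes m = nodes m"
  using peak_flip[of m 0 0 0] by (simp add: peak_zero)

lemma swap_cells: "W \<in> cells m \<Longrightarrow> swap ` W \<in> cells m"
  using swap_nodes[of m] by (auto simp: cells_def swap_facet_sets swap_edge_sets)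
lemma flip_cells: "W \<in> cells m \<Longrightarrow> flip ` W \<in> cells m"
  using flip_nodes[of m] by (auto simp: cells_def flip_facet_sets flip_edge_sets)

lemma slope_mono: "0 < d \<Longrightarrow> strict_mono (\<lambda>r. real r * d)"
  by (simp add: strict_mono_def)
lemma mixed_mono: "c < 0 \<Longrightarrow> 0 < b \<Longrightarrow> strict_mono (\<lambda>r. real r * b + (real m - real r) * c)"
proof (rule strict_monoI)
  fix r s :: nat assume "c < 0" "0 < b" "r < s"
  then have "0 < (real s - real r) * (b - c)" by simp
  then show "real r * b + (real m - real r) * c < real s * b + (real m - real s) * c"
    by (simp add: algebra_simps)
qed
lemma mixed_mono': "c < 0 \<Longrightarrow> 0 < b \<Longrightarrow> strict_mono (\<lambda>r. - (real r * c) - (real m - real r) * b)"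
  using mixed_mono[of "- b" "- c" m] by simp

lemma singleton_cells: "i \<in> nodes m \<Longrightarrow> {i} \<in> cells m" by (auto simp: cells_def)

lemma peak_cells_quadrant:
  assumes "0 < m" "0 < c" "c < b"
  shows "peak m a b c \<in> cells m"
proof -
  have mono: "strict_mono (\<lambda>r. real r * (b - c))" using assms by (intro slope_mono) simp
  consider "a < 0" | "a = 0" | "0 < a" by linarith
  then show ?thesis
  proof cases
    case 1 then show ?thesis using assms by (auto simp: peak_quadrant nodes_def intro!: singleton_cells)
  next
    case 2
    have "window m (\<lambda>r. real r * (b - c)) 0 = {0}"
      by (rule window_low[OF mono]) (use assms in auto)
    then have "peak m a b c = {(True, True, True, 0), (False, True, True, m)}"
      using 2 assms by (auto simp: peak_quadrant)
    then show ?thesis using edge_sets.closing[of True True m] by (auto simp: cells_def)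
  next
    case 3
    then have low: "real 0 * (b - c) < a" by simp
    show ?thesis
    proof (cases rule: window_cases[OF mono low, of m, case_names tie gap])
      case (tie r)
      have "peak m a b c = {(True, True, True, r), (True, True, True, Suc r)}"
        using 3 assms tie(3) by (auto simp: peak_quadrant)
      then show ?thesis using tie edge_sets.chain_step[of r m True True True] by (auto simp: cells_def)
    next
      case (gap r)
      have "peak m a b c = {(True, True, True, r)}"
        using 3 assms gap(4) by (auto simp: peak_quadrant)
      then show ?thesis using gap by (auto simp: nodes_def intro!: singleton_cells)
    qed
  qed
qed

lemma peak_cells_diagonal: "0 < b \<Longrightarrow> peak m a b b \<in> cells m"
  using facet_sets.belts[of m True]
  by (auto simp: peak_diagonal nodes_def belt_def cells_def)

lemma peak_cells_wall:
  assumes "0 < m" "0 < c"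
  shows "peak m a 0 c \<in> cells m"
proof -
  consider "a < 0" | "a = 0" | "0 < a" by linarith
  then show ?thesis
  proof cases
    case 1
    have mono: "strict_mono (\<lambda>r. real r * c)" using assms by (intro slope_mono)
    have low: "real 0 * c < - a" using 1 by simp
    show ?thesis
    proof (cases rule: window_cases[OF mono low, of m, case_names tie gap])
      case (tie r)
      have "peak m a 0 c = panel False True r"
        using 1 assms tie(3) by (auto simp: peak_wall_neg panel_def)
      then show ?thesis using tie facet_sets.panels[of r m False True] by (auto simp: cells_def)
    next
      case (gap r)
      have "peak m a 0 c = {(False, True, True, r), (False, False, True, r)}"
        using 1 assms gap(4) by (auto simp: peak_wall_neg)
      then show ?thesis using gap edge_sets.lower_rung[of r m True] by (auto simp: cells_def)
    qed
  next
    case 2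
    then show ?thesis using assms facet_sets.pentagons[of m True True] by (auto simp: cells_def pentagon_def peak_wall_zero)
  next
    case 3
    then have "peak m a 0 c = {(True, True, True, m), (True, False, True, m)}"
      using assms by (auto simp: peak_wall_pos)
    then show ?thesis using edge_sets.upper_cap[of True m] by (auto simp: cells_def)
  qed
qed

text \<open>For $a = 0$ the thresholds $f$ and $g$ of the upper and the lower chain satisfy $g(m - r) = - f(r)$, so a tie on one
chain is a tie on the other: without a tie the peak is a \<open>crossing\<close> edge, and two ties combine to a \<open>bridge\<close>.\<close>

lemma peak_mixed_zero:
  assumes "c < 0" "0 < b" "r < m"
  shows peak_mixed_zero_open: "real r * b + (real m - real r) * c < 0 \<Longrightarrow>
      0 < real (Suc r) * b + (real m - real (Suc r)) * c \<Longrightarrow>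
      peak m 0 b c = {(True, True, False, r), (False, True, False, m - 1 - r)}"
    and peak_mixed_zero_tie: "real (Suc r) * b + (real m - real (Suc r)) * c = 0 \<Longrightarrow>
      peak m 0 b c = bridge m True r \<and> r < m - 1"
proof -
  define f g where "f = (\<lambda>r. real r * b + (real m - real r) * c)"
    and "g = (\<lambda>r. - (real r * c) - (real m - real r) * b)"
  have mono: "strict_mono f" "strict_mono g"
    unfolding f_def g_def using assms by (auto intro: mixed_mono mixed_mono')
  have gf: "g (m - r) = - f r" if "r \<le> m" for r
    using that by (simp add: f_def g_def of_nat_diff)
  have peak: "peak m 0 b c = {True} \<times> {True} \<times> {False} \<times> window m f 0
      \<union> {False} \<times> {True} \<times> {False} \<times> window m g 0"
    unfolding f_def g_def using peak_mixed[OF assms(1,2), of m 0] by simp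
  show "peak m 0 b c = {(True, True, False, r), (False, True, False, m - 1 - r)}"
    if "real r * b + (real m - real r) * c < 0" "0 < real (Suc r) * b + (real m - real (Suc r)) * c"
  proof -
    have f: "f r < 0" "0 < f (Suc r)" using that by (auto simp: f_def)
    have "window m f 0 = {r}"
      by (rule window_open[OF mono(1)]) (use f assms(3) in auto)
    moreover have "window m g 0 = {m - 1 - r}"
    proof (rule window_open[OF mono(2)])
      have "Suc (m - 1 - r) = m - r" using assms(3) by auto
      then show "0 < g (Suc (m - 1 - r))" using gf[of r] f assms(3) by (simp only:)
      show "g (m - 1 - r) < 0" using gf[of "Suc r"] f assms(3) by simp
    qed simp
    ultimately show ?thesis unfolding peak by auto
  qed
  show "peak m 0 b c = bridge m True r \<and> r < m - 1"
    if "real (Suc r) * b + (real m - real (Suc r)) * c = 0"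
  proof -
    have f: "f (Suc r) = 0" using that by (simp add: f_def)
    have "0 < f m" using assms by (simp add: f_def)
    with f have "Suc r \<noteq> m" by auto
    with assms(3) have r: "r < m - 1" by simp
    then have e: "Suc (m - 2 - r) = m - 1 - r" "m - 2 - r < m" by auto
    have "g (m - 1 - r) = 0" using gf[of "Suc r"] f assms(3) by simp
    then have g: "window m g 0 = {m - 2 - r, m - 1 - r}"
      using window_tie[OF mono(2) e(2)] by (simp only: e(1))
    have "window m f 0 = {r, Suc r}" using window_tie[OF mono(1) assms(3)] f by simp
    with g have "peak m 0 b c = {True} \<times> {True} \<times> {False} \<times> {r, Suc r}
        \<union> {False} \<times> {True} \<times> {False} \<times> {m - 2 - r, m - 1 - r}"
      unfolding peak by (simp only:)
    also have "\<dots> = bridge m True r" by (auto simp: bridge_def)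
    finally show ?thesis using r by blast
  qed
qed

lemma peak_cells_mixed:
  assumes "0 < m" "c < 0" "0 < b"
  shows "peak m a b c \<in> cells m"
proof -
  let ?f = "\<lambda>r. real r * b + (real m - real r) * c"
  let ?g = "\<lambda>r. - (real r * c) - (real m - real r) * b"
  consider "a < 0" | "a = 0" | "0 < a" by linarith
  then show ?thesis
  proof cases
    case 1
    have "0 < real m * b" using assms by simp
    then have low: "?g 0 < - a" using 1 by simp
    show ?thesis
    proof (cases rule: window_cases[OF mixed_mono'[OF assms(2,3)] low, of m, case_names tie gap])
      case (tie r)
      have "peak m a b c = {(False, True, False, r), (False, True, False, Suc r)}"
        unfolding peak_mixed[OF assms(2,3)] using 1 tie(3) by auto
      then show ?thesis using tie edge_sets.chain_step[of r m False True False] by (auto simp: cells_def)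
    next
      case (gap r)
      have "peak m a b c = {(False, True, False, r)}"
        unfolding peak_mixed[OF assms(2,3)] using 1 gap(4) by auto
      then show ?thesis using gap by (auto simp: nodes_def intro!: singleton_cells)
    qed
  next
    case 2
    have low: "?f 0 < 0" using assms by (simp add: mult_pos_neg)
    show ?thesis
    proof (cases rule: window_cases[OF mixed_mono[OF assms(2,3)] low, of m, case_names tie gap])
      case (tie r)
      then show ?thesis
        using peak_mixed_zero_tie[OF assms(2,3), of r m] 2 facet_sets.bridges[of r m True]
        by (auto simp: cells_def)
    next
      case (gap r)
      have "0 < real m * b" using assms by simp
      then have "r \<noteq> m" using gap(2) by auto
      with gap(1) have "r < m" by simp
      then show ?thesis
        using peak_mixed_zero_open[OF assms(2,3), of r m] gap(2,3) 2 edge_sets.crossing[of r m True]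
        by (auto simp: cells_def)
    qed
  next
    case 3
    have "real m * c < 0" using assms by (simp add: mult_pos_neg)
    then have low: "?f 0 < a" using 3 by simp
    show ?thesis
    proof (cases rule: window_cases[OF mixed_mono[OF assms(2,3)] low, of m, case_names tie gap])
      case (tie r)
      have "peak m a b c = {(True, True, False, r), (True, True, False, Suc r)}"
        unfolding peak_mixed[OF assms(2,3)] using 3 tie(3) by auto
      then show ?thesis using tie edge_sets.chain_step[of r m True True False] by (auto simp: cells_def)
    next
      case (gap r)
      have "peak m a b c = {(True, True, False, r)}"
        unfolding peak_mixed[OF assms(2,3)] using 3 gap(4) by auto
      then show ?thesis using gap by (auto simp: nodes_def intro!: singleton_cells)
    qed
  qed
qed

text \<open>By \<open>flip\<close> and \<open>swap\<close> every direction can be moved to one with $(b, c) = 0$, $b = 0 < c$,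
$0 < c \le b$ or $c < 0 < b$.\<close>

lemma peak_cells:
  assumes "0 < m"
  shows "peak m a b c \<in> cells m"
proof -
  have sw: "peak m a b c \<in> cells m" if "peak m (- a) c b \<in> cells m" for a b c
    using swap_cells[OF that] peak_swap[of m "- a" b c] by simp
  have fl: "peak m a b c \<in> cells m" if "peak m a (- b) (- c) \<in> cells m" for a b c
    using flip_cells[OF that] peak_flip[of m a "- b" "- c"] by simp
  have zero: "peak m a 0 0 \<in> cells m" for a
  proof -
    have "peak m a 0 0 \<in> cells m" if "0 < a" for a
      using peak_pole[OF that, of m] facet_sets.caps[of m True] by (simp add: cells_def cap_def)
    moreover have "peak m 0 0 0 \<in> cells m" by (simp add: peak_zero cells_def)
    ultimately show ?thesis using sw[of a 0 0] by (metis linorder_neqE_linordered_idom neg_0_less_iff_less)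
  qed
  have wall: "peak m a 0 c \<in> cells m" for a c
    using zero[of a] peak_cells_wall[OF assms, of c a] peak_cells_wall[OF assms, of "- c" a] fl[of a 0 c]
    by (cases "c = 0"; cases "0 < c") auto
  have pos: "peak m a b c \<in> cells m" if "0 < b" "0 < c" for a b c
    using that peak_cells_quadrant[OF assms, of c b a] peak_cells_diagonal[of b m a]
      peak_cells_quadrant[OF assms, of b c "- a"] sw[of a c b]
    by (cases b c rule: linorder_cases) auto
  consider "b = 0" | "c = 0" | "0 < b" "0 < c" | "b < 0" "c < 0" | "c < 0" "0 < b" | "b < 0" "0 < c"
    by linarith
  then show ?thesis
  proof cases
    case 1
    then show ?thesis using wall by simp
  next
    case 2
    then show ?thesis using sw[of a c b] wall[of "- a" b] by simp
  next
    case 3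
    then show ?thesis by (rule pos)
  next
    case 4
    then show ?thesis using fl[of a b c] pos[of "- b" "- c" a] by simp
  next
    case 5
    then show ?thesis using peak_cells_mixed[OF assms] by simp
  next
    case 6
    then show ?thesis using fl[of a b c] peak_cells_mixed[OF assms, of "- c" "- b" a] by simp
  qed
qed

section \<open>Every member of the lists is a peak\<close>

definition peaks :: "nat \<Rightarrow> node set set" where
  "peaks m = {peak m a b c |a b c. True}"

lemma peaksI: "peak m a b c = W \<Longrightarrow> W \<in> peaks m" by (auto simp: peaks_def)

lemma swap_peaks_iff: "swap ` W \<in> peaks m \<longleftrightarrow> W \<in> peaks m"
proof
  have *: "swap ` W \<in> peaks m" if W: "W \<in> peaks m" for W
  proof -
    from W obtain a b c where "W = peak m a b c" by (auto simp: peaks_def)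
    then show ?thesis using peaksI[OF peak_swap] by simp
  qed
  show "swap ` W \<in> peaks m" if "W \<in> peaks m" using *[OF that] .
  show "W \<in> peaks m" if "swap ` W \<in> peaks m" using *[OF that] by (simp add: image_image)
qed

lemma flip_peaks_iff: "flip ` W \<in> peaks m \<longleftrightarrow> W \<in> peaks m"
proof
  have *: "flip ` W \<in> peaks m" if W: "W \<in> peaks m" for W
  proof -
    from W obtain a b c where "W = peak m a b c" by (auto simp: peaks_def)
    then show ?thesis using peaksI[OF peak_flip] by simp
  qed
  show "flip ` W \<in> peaks m" if "W \<in> peaks m" using *[OF that] .
  show "W \<in> peaks m" if "flip ` W \<in> peaks m" using *[OF that] by (simp add: image_image)
qed

text \<open>The eight sign patterns form two orbits under the symmetries, one with equal and one with different signs of $b$ and $c$, and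
the position $r$ does not move; so one representative of each orbit suffices.\<close>

lemma column_peaks:
  assumes "{True} \<times> {True} \<times> {True} \<times> N \<in> peaks m" "{True} \<times> {True} \<times> {False} \<times> N \<in> peaks m"
  shows "{\<alpha>} \<times> {\<beta>} \<times> {\<gamma>} \<times> N \<in> peaks m"
proof -
  have fl: "flip ` ({\<alpha>} \<times> {\<beta>} \<times> {\<gamma>} \<times> N) = {\<alpha>} \<times> {\<not> \<beta>} \<times> {\<not> \<gamma>} \<times> N" for \<alpha> \<beta> \<gamma>
    unfolding flip_image by auto
  have sw: "swap ` ({\<alpha>} \<times> {\<beta>} \<times> {\<gamma>} \<times> N) = {\<not> \<alpha>} \<times> {\<gamma>} \<times> {\<beta>} \<times> N" for \<alpha> \<beta> \<gamma>
    unfolding swap_image by auto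
  have T: "{True} \<times> {\<beta>} \<times> {\<gamma>} \<times> N \<in> peaks m" for \<beta> \<gamma>
    using assms flip_peaks_iff[of "{True} \<times> {\<beta>} \<times> {\<gamma>} \<times> N" m]
    by (cases \<beta>; cases \<gamma>) (simp_all add: fl)
  show ?thesis
    using T[of \<beta> \<gamma>] T[of \<gamma> \<beta>] swap_peaks_iff[of "{\<alpha>} \<times> {\<beta>} \<times> {\<gamma>} \<times> N" m]
    by (cases \<alpha>) (simp_all add: sw)
qed

lemma singleton_peaks:
  assumes "0 < m" "i \<in> nodes m"
  shows "{i} \<in> peaks m"
proof -
  obtain \<alpha> \<beta> \<gamma> r where i: "i = (\<alpha>, \<beta>, \<gamma>, r)" and r: "r \<le> m" using assms(2) by (auto simp: nodes_def)
  have "window m (\<lambda>r. real r * (2 - 1)) (real r + 1 / 2) = {r}"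
    using r by (intro window_open slope_mono) auto
  then have "peak m (real r + 1 / 2) 2 1 = {True} \<times> {True} \<times> {True} \<times> {r}"
    by (auto simp: peak_quadrant)
  then have pp: "{True} \<times> {True} \<times> {True} \<times> {r} \<in> peaks m" by (rule peaksI)
  let ?f = "\<lambda>r. real r * real m + (real m - real r) * (- 1)"
  \<comment> \<open>For $b = m$ and $c = -1$ the thresholds are $r(m + 1) - m$; the value $a$ is positive even for $r = 0$.\<close>
  define a where "a = real r * (real m + 1) + 1 / 2"
  have "0 \<le> real r * (real m + 1)" by simp
  then have a: "0 < a" unfolding a_def by linarith
  have "window m ?f a = {r}"
  proof (rule window_open)
    show "strict_mono ?f" using assms by (intro mixed_mono) auto
    show "?f r < a" using assms by (simp add: a_def algebra_simps)
    show "a < ?f (Suc r)" using assms by (simp add: a_def algebra_simps)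
  qed (use r in auto)
  then have "peak m a (real m) (- 1) = {True} \<times> {True} \<times> {False} \<times> {r}"
    using a assms peak_mixed[of "- 1" "real m" m a] by auto
  then have "{True} \<times> {True} \<times> {False} \<times> {r} \<in> peaks m" by (rule peaksI)
  from column_peaks[OF pp this, of \<alpha> \<beta> \<gamma>] show ?thesis by (simp add: i)
qed

lemma lower_rung_peak:
  assumes "r \<le> m"
  shows "{(False, True, True, r), (False, False, True, r)} \<in> peaks m"
proof -
  have w: "window m (\<lambda>r. real r * 1) (real r + 1 / 2) = {r}"
    using assms by (intro window_open slope_mono) auto
  have "- (real r + 1 / 2) < 0" by linarith
  from peak_wall_neg[OF this zero_less_one, of m]
  have "peak m (- (real r + 1 / 2)) 0 1 = {False} \<times> UNIV \<times> {True} \<times> {r}"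
    by (simp only: minus_minus w)
  also have "\<dots> = {(False, True, True, r), (False, False, True, r)}" by auto
  finally show ?thesis by (rule peaksI)
qed

lemma edge_peaks:
  assumes m: "0 < m" and W: "W \<in> edge_sets m"
  shows "W \<in> peaks m"
  using W
proof (cases rule: edge_sets.cases)
  case (chain_step r \<alpha> \<beta> \<gamma>)
  have "window m (\<lambda>r. real r * (2 - 1)) (real (Suc r) * (2 - 1)) = {r, Suc r}"
    using chain_step by (intro window_tie slope_mono) auto
  then have "peak m (real (Suc r)) 2 1 = {True} \<times> {True} \<times> {True} \<times> {r, Suc r}"
    by (simp add: peak_quadrant del: of_nat_Suc)
  then have pp: "{True} \<times> {True} \<times> {True} \<times> {r, Suc r} \<in> peaks m" by (rule peaksI)
  let ?f = "\<lambda>r. real r * real m + (real m - real r) * (- 1)"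
  have "0 \<le> real r * (real m + 1)" by simp
  moreover have "?f (Suc r) = 1 + real r * (real m + 1)" by (simp add: algebra_simps)
  ultimately have a: "0 < ?f (Suc r)" by linarith
  have "window m ?f (?f (Suc r)) = {r, Suc r}"
    using chain_step m by (intro window_tie mixed_mono) auto
  then have "peak m (?f (Suc r)) (real m) (- 1) = {True} \<times> {True} \<times> {False} \<times> {r, Suc r}"
    using a m peak_mixed[of "- 1" "real m" m "?f (Suc r)"] by simp
  then have "{True} \<times> {True} \<times> {False} \<times> {r, Suc r} \<in> peaks m" by (rule peaksI)
  from column_peaks[OF pp this, of \<alpha> \<beta> \<gamma>] show ?thesis by (simp add: chain_step)
next
  case (lower_rung r \<gamma>)
  have "{(False, True, True, r), (False, False, True, r)} \<in> peaks m"
    using lower_rung by (intro lower_rung_peak)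
  then show ?thesis using flip_peaks_iff[of W m] by (cases \<gamma>) (auto simp: lower_rung insert_commute)
next
  case (upper_rung r \<beta>)
  have "{(False, True, True, r), (False, False, True, r)} \<in> peaks m"
    using upper_rung by (intro lower_rung_peak)
  then have "{(False, True, \<beta>, r), (False, False, \<beta>, r)} \<in> peaks m"
    using flip_peaks_iff[of "{(False, True, \<beta>, r), (False, False, \<beta>, r)}" m] by (cases \<beta>) (auto simp: insert_commute)
  then show ?thesis using swap_peaks_iff[of W m] by (auto simp: upper_rung)
next
  case (upper_cap \<gamma>)
  have "peak m 1 0 1 = {(True, True, True, m), (True, False, True, m)}"
    by (auto simp: peak_wall_pos)
  then have "{(True, True, True, m), (True, False, True, m)} \<in> peaks m" by (rule peaksI)
  then show ?thesis using flip_peaks_iff[of W m] by (cases \<gamma>) (auto simp: upper_cap insert_commute)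
next
  case (lower_cap \<beta>)
  have "peak m 1 0 1 = {(True, True, True, m), (True, False, True, m)}"
    by (auto simp: peak_wall_pos)
  then have "{(True, True, True, m), (True, False, True, m)} \<in> peaks m" by (rule peaksI)
  then have "{(True, True, \<beta>, m), (True, False, \<beta>, m)} \<in> peaks m"
    using flip_peaks_iff[of "{(True, True, \<beta>, m), (True, False, \<beta>, m)}" m] by (cases \<beta>) (auto simp: insert_commute)
  then show ?thesis using swap_peaks_iff[of W m] by (auto simp: lower_cap)
next
  case (closing \<alpha> \<beta>)
  have "window m (\<lambda>r. real r * (2 - 1)) 0 = {0}"
    using m by (intro window_low slope_mono) auto
  then have "peak m 0 2 1 = {(True, True, True, 0), (False, True, True, m)}"
    by (auto simp: peak_quadrant)
  then have "{(True, True, True, 0), (False, True, True, m)} \<in> peaks m" by (rule peaksI)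
  then have "{(\<alpha>, True, True, 0), (\<not> \<alpha>, True, True, m)} \<in> peaks m"
    using swap_peaks_iff[of "{(\<alpha>, True, True, 0), (\<not> \<alpha>, True, True, m)}" m] by (cases \<alpha>) auto
  then show ?thesis using flip_peaks_iff[of W m] by (cases \<beta>) (auto simp: closing)
next
  case (crossing r \<beta>)
  \<comment> \<open>A direction with threshold $-m$ at $r$ and threshold $m$ at $r + 1$.\<close>
  define b where "b = 2 * (real m - real r) - 1"
  define c where "c = - (2 * real r + 1)"
  have r: "real r + 1 \<le> real m" using crossing by simp
  have "peak m 0 b c = {(True, True, False, r), (False, True, False, m - 1 - r)}"
  proof (rule peak_mixed_zero_open)
    show "c < 0" "0 < b" using r by (auto simp: b_def c_def)
    have "real r * b + (real m - real r) * c = - real m" by (simp add: b_def c_def algebra_simps)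
    then show "real r * b + (real m - real r) * c < 0" using m by simp
    have "real (Suc r) * b + (real m - real (Suc r)) * c = real m"
      by (simp add: b_def c_def algebra_simps)
    then show "0 < real (Suc r) * b + (real m - real (Suc r)) * c" using m by simp
  qed (fact crossing)
  then have "{(True, True, False, r), (False, True, False, m - 1 - r)} \<in> peaks m" by (rule peaksI)
  then show ?thesis using flip_peaks_iff[of W m] by (cases \<beta>) (auto simp: crossing)
qed

lemma facet_peaks:
  assumes m: "0 < m" and W: "W \<in> facet_sets m"
  shows "W \<in> peaks m"
  using W
proof (cases rule: facet_sets.cases)
  case (caps \<alpha>)
  have "peak m 1 0 0 = cap m True" by (simp add: peak_pole cap_def)
  then have "cap m True \<in> peaks m" by (rule peaksI)
  then show ?thesis using swap_peaks_iff[of W m] by (cases \<alpha>) (auto simp: caps swap_shapes)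
next
  case (belts \<beta>)
  have "peak m 0 1 1 = belt m True" by (simp add: peak_diagonal belt_def)
  then have "belt m True \<in> peaks m" by (rule peaksI)
  then show ?thesis using flip_peaks_iff[of W m] by (cases \<beta>) (auto simp: belts flip_shapes)
next
  case (panels r \<alpha> p)
  have "window m (\<lambda>r. real r * 1) (real (Suc r) * 1) = {r, Suc r}"
    using panels by (intro window_tie slope_mono) auto
  then have "peak m (- real (Suc r)) 0 1 = panel False True r"
    by (simp add: peak_wall_neg panel_def del: of_nat_Suc)
  then have "panel False True r \<in> peaks m" by (rule peaksI)
  then have "panel False p r \<in> peaks m"
    using flip_peaks_iff[of "panel False p r" m] by (cases p) (auto simp: flip_shapes)
  then show ?thesis using swap_peaks_iff[of W m] by (cases \<alpha>) (auto simp: panels swap_shapes)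
next
  case (bridges r p)
  \<comment> \<open>A direction whose threshold at $r + 1$ vanishes.\<close>
  define b where "b = real m - real (Suc r)"
  define c where "c = - real (Suc r)"
  have "peak m 0 b c = bridge m True r \<and> r < m - 1"
    by (rule peak_mixed_zero_tie) (use bridges in \<open>auto simp: b_def c_def algebra_simps\<close>)
  then have "bridge m True r \<in> peaks m" by (auto intro: peaksI)
  then show ?thesis using flip_peaks_iff[of W m] by (cases p) (auto simp: bridges flip_shapes)
next
  case (pentagons \<alpha> p)
  have "peak m 0 0 1 = pentagon m True True" using m by (simp add: peak_wall_zero pentagon_def)
  then have "pentagon m True True \<in> peaks m" by (rule peaksI)
  then have "pentagon m True p \<in> peaks m"
    using flip_peaks_iff[of "pentagon m True p" m] by (cases p) (auto simp: flip_shapes)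
  then show ?thesis using swap_peaks_iff[of W m] by (cases \<alpha>) (auto simp: pentagons swap_shapes)
qed

section \<open>Counting\<close>

lemma card_nodes: "card (nodes m) = 8 * (m + 1)"
  by (simp add: nodes_def card_cartesian_product)

lemma finite_nodes: "finite (nodes m)"
  by (simp add: nodes_def)

lemma card_edge_set: "W \<in> edge_sets m \<Longrightarrow> card W = 2"
  by (elim edge_sets.cases) auto

lemma card_cap: "card (cap m \<alpha>) = 4"
  by (simp add: cap_def card_cartesian_product)

lemma card_panel: "card (panel \<alpha> p r) = 4"
  by (simp add: panel_def card_cartesian_product)

lemma card_bridge: "r < m - 1 \<Longrightarrow> card (bridge m p r) = 4"
  by (auto simp: bridge_def)

lemma card_pentagon: "0 < m \<Longrightarrow> card (pentagon m \<alpha> p) = 5"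
  by (auto simp: pentagon_def)

lemma card_belt: "card (belt m \<beta>) = 2 * (m + 1)"
proof -
  have "belt m \<beta> = (\<lambda>(\<alpha>, r). (\<alpha>, \<beta>, \<beta>, r)) ` (UNIV \<times> {..m})"
    by (auto simp: belt_def)
  moreover have "inj_on (\<lambda>(\<alpha> :: bool, r). (\<alpha>, \<beta>, \<beta>, r)) (UNIV \<times> {..m})"
    by (auto simp: inj_on_def)
  ultimately show ?thesis by (simp only: card_image) (simp add: card_cartesian_product)
qed

lemma card_facet_set:
  assumes "0 < m" "W \<in> facet_sets m"
  shows "3 \<le> card W" "card W < card (nodes m)"
  using assms(2)
  by (cases rule: facet_sets.cases;
      use assms(1) in \<open>simp add: card_cap card_belt card_panel card_bridge card_pentagon card_nodes\<close>)+

lemma peaks_subset_cells: "0 < m \<Longrightarrow> peaks m \<subseteq> cells m"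
  using peak_cells by (auto simp: peaks_def)

lemma peaks_card_2:
  assumes "0 < m"
  shows "{W \<in> peaks m. card W = 2} = edge_sets m"
proof
  show "{W \<in> peaks m. card W = 2} \<subseteq> edge_sets m"
  proof
    fix W assume W: "W \<in> {W \<in> peaks m. card W = 2}"
    then have "W \<in> cells m" using peaks_subset_cells[OF assms] by auto
    then show "W \<in> edge_sets m"
      using W card_facet_set(1)[OF assms, of W] by (auto simp: cells_def card_nodes)
  qed
qed (use edge_peaks[OF assms] card_edge_set in auto)

lemma peaks_card_ge_3:
  assumes "0 < m"
  shows "{W \<in> peaks m. 3 \<le> card W \<and> W \<noteq> nodes m} = facet_sets m"
proof
  show "{W \<in> peaks m. 3 \<le> card W \<and> W \<noteq> nodes m} \<subseteq> facet_sets m"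
  proof
    fix W assume W: "W \<in> {W \<in> peaks m. 3 \<le> card W \<and> W \<noteq> nodes m}"
    then have "W \<in> cells m" using peaks_subset_cells[OF assms] by auto
    then show "W \<in> facet_sets m"
      using W card_edge_set[of W m] by (auto simp: cells_def)
  qed
  show "facet_sets m \<subseteq> {W \<in> peaks m. 3 \<le> card W \<and> W \<noteq> nodes m}"
  proof
    fix W assume "W \<in> facet_sets m"
    then show "W \<in> {W \<in> peaks m. 3 \<le> card W \<and> W \<noteq> nodes m}"
      using facet_peaks[OF assms] card_facet_set[OF assms, of W] by auto
  qed
qed

lemma bool_singleton_neq_UNIV: "{p :: bool} \<noteq> UNIV" "UNIV \<noteq> {p :: bool}"
  by (metis (full_types) UNIV_I singletonD)+

lemma card_UNIV_bool_bool: "card (UNIV :: (bool \<times> bool) set) = 4"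
  by (simp only: UNIV_Times_UNIV[symmetric] card_cartesian_product) simp

text \<open>The sets of signs that occur in an edge already tell the families of edges apart.\<close>

definition signs :: "node set \<Rightarrow> bool set \<times> bool set \<times> bool set" where
  "signs W = (fst ` W, (\<lambda>i. fst (snd i)) ` W, (\<lambda>i. fst (snd (snd i))) ` W)"

lemma card_edge_sets:
  assumes "0 < m"
  shows "card (edge_sets m) = 14 * m + 12"
proof -
  define E1 where "E1 = (\<lambda>(\<alpha>, \<beta>, \<gamma>, r). {(\<alpha>, \<beta>, \<gamma>, r), (\<alpha>, \<beta>, \<gamma>, Suc r)}) ` ((UNIV :: bool set) \<times> (UNIV :: bool set) \<times> (UNIV :: bool set) \<times> {..<m})"
  define E2 where "E2 = (\<lambda>(\<beta>, r). {(True, \<beta>, True, r), (True, \<beta>, False, r)}) ` ((UNIV :: bool set) \<times> {..m})"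
  define E3 where "E3 = (\<lambda>(\<gamma>, r). {(False, True, \<gamma>, r), (False, False, \<gamma>, r)}) ` ((UNIV :: bool set) \<times> {..m})"
  define E4 where "E4 = (\<lambda>\<gamma>. {(True, True, \<gamma>, m), (True, False, \<gamma>, m)}) ` (UNIV :: bool set)"
  define E5 where "E5 = (\<lambda>\<beta>. {(False, \<beta>, True, m), (False, \<beta>, False, m)}) ` (UNIV :: bool set)"
  define E6 where "E6 = (\<lambda>(\<alpha>, \<beta>). {(\<alpha>, \<beta>, \<beta>, 0), (\<not> \<alpha>, \<beta>, \<beta>, m)}) ` ((UNIV :: bool set) \<times> (UNIV :: bool set))"
  define E7 where "E7 = (\<lambda>(\<beta>, r). {(True, \<beta>, \<not> \<beta>, r), (False, \<beta>, \<not> \<beta>, m - 1 - r)}) ` ((UNIV :: bool set) \<times> {..<m})"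
  note defs = E1_def E2_def E3_def E4_def E5_def E6_def E7_def
  have "edge_sets m = E1 \<union> (E2 \<union> (E3 \<union> (E4 \<union> (E5 \<union> (E6 \<union> E7)))))"
  proof
    show "edge_sets m \<subseteq> E1 \<union> (E2 \<union> (E3 \<union> (E4 \<union> (E5 \<union> (E6 \<union> E7)))))"
    proof
      fix W assume "W \<in> edge_sets m"
      then have "W \<in> E1 \<or> W \<in> E2 \<or> W \<in> E3 \<or> W \<in> E4 \<or> W \<in> E5 \<or> W \<in> E6 \<or> W \<in> E7"
      proof (cases rule: edge_sets.cases)
        case (chain_step r \<alpha> \<beta> \<gamma>)
        then have "W \<in> E1" unfolding E1_def by (intro image_eqI[of _ _ "(\<alpha>, \<beta>, \<gamma>, r)"]) simp_all
        then show ?thesis by simp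
      next
        case (upper_rung r \<beta>)
        then have "W \<in> E2" unfolding E2_def by (intro image_eqI[of _ _ "(\<beta>, r)"]) simp_all
        then show ?thesis by simp
      next
        case (lower_rung r \<gamma>)
        then have "W \<in> E3" unfolding E3_def by (intro image_eqI[of _ _ "(\<gamma>, r)"]) simp_all
        then show ?thesis by simp
      next
        case (upper_cap \<gamma>)
        then have "W \<in> E4" unfolding E4_def by (intro image_eqI[of _ _ \<gamma>]) simp_all
        then show ?thesis by simp
      next
        case (lower_cap \<beta>)
        then have "W \<in> E5" unfolding E5_def by (intro image_eqI[of _ _ \<beta>]) simp_all
        then show ?thesis by simp
      next
        case (closing \<alpha> \<beta>)
        then have "W \<in> E6" unfolding E6_def by (intro image_eqI[of _ _ "(\<alpha>, \<beta>)"]) simp_all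
        then show ?thesis by simp
      next
        case (crossing r \<beta>)
        then have "W \<in> E7" unfolding E7_def by (intro image_eqI[of _ _ "(\<beta>, r)"]) simp_all
        then show ?thesis by simp
      qed
      then show "W \<in> E1 \<union> (E2 \<union> (E3 \<union> (E4 \<union> (E5 \<union> (E6 \<union> E7)))))" by blast
    qed
    show "E1 \<union> (E2 \<union> (E3 \<union> (E4 \<union> (E5 \<union> (E6 \<union> E7))))) \<subseteq> edge_sets m"
      by (auto simp: defs intro: edge_sets.intros edge_sets.crossing[simplified])
  qed
  moreover have "E6 \<inter> E7 = {}" "E5 \<inter> (E6 \<union> E7) = {}" "E4 \<inter> (E5 \<union> (E6 \<union> E7)) = {}"
    "E3 \<inter> (E4 \<union> (E5 \<union> (E6 \<union> E7))) = {}" "E2 \<inter> (E3 \<union> (E4 \<union> (E5 \<union> (E6 \<union> E7)))) = {}"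
    "E1 \<inter> (E2 \<union> (E3 \<union> (E4 \<union> (E5 \<union> (E6 \<union> E7))))) = {}"
  proof -
    have UNIV_eq: "{True, False} = UNIV" "{False, True} = UNIV" "{p, \<not> p} = UNIV" "{\<not> p, p} = UNIV" for p by auto
    have s: "\<And>W. W \<in> E1 \<Longrightarrow> \<exists>\<alpha> \<beta> \<gamma>. signs W = ({\<alpha>}, {\<beta>}, {\<gamma>})"
      "\<And>W. W \<in> E2 \<Longrightarrow> \<exists>\<beta>. signs W = ({True}, {\<beta>}, UNIV)"
      "\<And>W. W \<in> E3 \<Longrightarrow> \<exists>\<gamma>. signs W = ({False}, UNIV, {\<gamma>})"
      "\<And>W. W \<in> E4 \<Longrightarrow> \<exists>\<gamma>. signs W = ({True}, UNIV, {\<gamma>})"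
      "\<And>W. W \<in> E5 \<Longrightarrow> \<exists>\<beta>. signs W = ({False}, {\<beta>}, UNIV)"
      "\<And>W. W \<in> E6 \<Longrightarrow> \<exists>\<beta>. signs W = (UNIV, {\<beta>}, {\<beta>})"
      "\<And>W. W \<in> E7 \<Longrightarrow> \<exists>\<beta>. signs W = (UNIV, {\<beta>}, {\<not> \<beta>})"
      by (force simp: defs signs_def UNIV_eq)+
    show "E6 \<inter> E7 = {}" "E5 \<inter> (E6 \<union> E7) = {}" "E4 \<inter> (E5 \<union> (E6 \<union> E7)) = {}"
      "E3 \<inter> (E4 \<union> (E5 \<union> (E6 \<union> E7))) = {}" "E2 \<inter> (E3 \<union> (E4 \<union> (E5 \<union> (E6 \<union> E7)))) = {}"
      "E1 \<inter> (E2 \<union> (E3 \<union> (E4 \<union> (E5 \<union> (E6 \<union> E7))))) = {}"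
      by (auto dest!: s simp: bool_singleton_neq_UNIV)
  qed
  moreover have "finite E1" "finite E2" "finite E3" "finite E4" "finite E5" "finite E6" "finite E7"
    by (simp_all add: defs)
  moreover have "card E1 = 8 * m" unfolding E1_def
    by (subst card_image) (auto simp: inj_on_def doubleton_eq_iff card_cartesian_product)
  moreover have "card E2 = 2 * (m + 1)" unfolding E2_def
    by (subst card_image) (auto simp: inj_on_def doubleton_eq_iff card_cartesian_product)
  moreover have "card E3 = 2 * (m + 1)" unfolding E3_def
    by (subst card_image) (auto simp: inj_on_def doubleton_eq_iff card_cartesian_product)
  moreover have "card E4 = 2" unfolding E4_def
    by (subst card_image) (auto simp: inj_on_def doubleton_eq_iff)
  moreover have "card E5 = 2" unfolding E5_def
    by (subst card_image) (auto simp: inj_on_def doubleton_eq_iff)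
  moreover have "card E6 = 4" unfolding E6_def
    by (subst card_image) (use assms in \<open>auto simp: inj_on_def doubleton_eq_iff card_UNIV_bool_bool\<close>)
  moreover have "card E7 = 2 * m" unfolding E7_def
    by (subst card_image) (auto simp: inj_on_def doubleton_eq_iff card_cartesian_product)
  ultimately show ?thesis by (simp add: card_Un_disjoint)
qed

text \<open>The signs that occur in a facet, and the positions that occur for either sign of $a$, tell all facets apart.\<close>

definition shape where
  "shape W = (fst ` W, {\<beta>. \<exists>\<alpha> \<gamma> r. (\<alpha>, \<beta>, \<gamma>, r) \<in> W}, {\<gamma>. \<exists>\<alpha> \<beta> r. (\<alpha>, \<beta>, \<gamma>, r) \<in> W},
     {r. \<exists>\<beta> \<gamma>. (True, \<beta>, \<gamma>, r) \<in> W}, {r. \<exists>\<beta> \<gamma>. (False, \<beta>, \<gamma>, r) \<in> W})" for W :: "node set"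

lemma shape_cap: "shape (cap m \<alpha>) = ({\<alpha>}, UNIV, UNIV, (if \<alpha> then {m} else {}), (if \<alpha> then {} else {m}))"
  by (auto simp: shape_def cap_def)
lemma shape_belt: "shape (belt m \<beta>) = (UNIV, {\<beta>}, {\<beta>}, {..m}, {..m})"
  by (auto simp: shape_def belt_def image_iff)
lemma shape_panel: "shape (panel \<alpha> p r) = ({\<alpha>}, (if \<alpha> then {p} else UNIV), (if \<alpha> then UNIV else {p}),
    (if \<alpha> then {r, Suc r} else {}), (if \<alpha> then {} else {r, Suc r}))"
  by (auto simp: shape_def panel_def)
lemma shape_bridge: "shape (bridge m p r) = (UNIV, {p}, {\<not> p}, {r, Suc r}, {m - 1 - r, m - 2 - r})"
  by (auto simp: shape_def bridge_def)
lemma shape_pentagon: "shape (pentagon m \<alpha> p) = (UNIV, (if \<alpha> then UNIV else {p}), (if \<alpha> then {p} else UNIV),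
    (if \<alpha> then {m, m - 1} else {0}), (if \<alpha> then {0} else {m, m - 1}))"
  by (auto simp: shape_def pentagon_def)

lemmas shapes = shape_cap shape_belt shape_panel shape_bridge shape_pentagon

lemma shape_neqI: "shape W \<noteq> shape W' \<Longrightarrow> W \<noteq> W'" by auto

lemma facet_families_distinct:
  "cap m \<alpha> \<noteq> belt m \<beta>" "cap m \<alpha> \<noteq> panel \<alpha>' p r" "cap m \<alpha> \<noteq> bridge m p r" "cap m \<alpha> \<noteq> pentagon m \<alpha>' p"
  "belt m \<beta> \<noteq> panel \<alpha>' p r" "belt m \<beta> \<noteq> bridge m p r" "belt m \<beta> \<noteq> pentagon m \<alpha>' p"
  "panel \<alpha> p r \<noteq> bridge m p' r'" "panel \<alpha> p r \<noteq> pentagon m \<alpha>' p'"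
  "bridge m p r \<noteq> pentagon m \<alpha>' p'"
  by (rule shape_neqI; auto simp: shapes bool_singleton_neq_UNIV)+

lemma inj_cap: "inj (cap m)"
proof (rule injI)
  fix \<alpha> \<alpha>' assume "cap m \<alpha> = cap m \<alpha>'"
  then have "shape (cap m \<alpha>) = shape (cap m \<alpha>')" by simp
  then show "\<alpha> = \<alpha>'" by (simp add: shapes)
qed

lemma inj_belt: "inj (belt m)"
proof (rule injI)
  fix \<alpha> \<alpha>' assume "belt m \<alpha> = belt m \<alpha>'"
  then have "shape (belt m \<alpha>) = shape (belt m \<alpha>')" by simp
  then show "\<alpha> = \<alpha>'" by (simp add: shapes)
qed

lemma inj_panel: "inj (\<lambda>(\<alpha>, p, r). panel \<alpha> p r)"
proof (rule injI)
  fix x y assume "(case x of (\<alpha>, p, r) \<Rightarrow> panel \<alpha> p r) = (case y of (\<alpha>, p, r) \<Rightarrow> panel \<alpha> p r)"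
  moreover obtain \<alpha> p r \<alpha>' p' r' where xy: "x = (\<alpha>, p, r)" "y = (\<alpha>', p', r')" by (cases x; cases y)
  ultimately have "shape (panel \<alpha> p r) = shape (panel \<alpha>' p' r')" by (simp add: xy)
  then show "x = y"
    by (auto simp: xy shapes doubleton_eq_iff split: if_splits)
qed

lemma inj_bridge: "inj (\<lambda>(p, r). bridge m p r)"
proof (rule injI)
  fix x y assume "(case x of (p, r) \<Rightarrow> bridge m p r) = (case y of (p, r) \<Rightarrow> bridge m p r)"
  moreover obtain p r p' r' where xy: "x = (p, r)" "y = (p', r')" by (cases x; cases y)
  ultimately have "shape (bridge m p r) = shape (bridge m p' r')" by (simp add: xy)
  then show "x = y"
    by (auto simp: xy shapes doubleton_eq_iff)
qed

lemma inj_pentagon: "inj (\<lambda>(\<alpha>, p). pentagon m \<alpha> p)"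
proof (rule injI)
  fix x y assume "(case x of (\<alpha>, p) \<Rightarrow> pentagon m \<alpha> p) = (case y of (\<alpha>, p) \<Rightarrow> pentagon m \<alpha> p)"
  moreover obtain \<alpha> p \<alpha>' p' where xy: "x = (\<alpha>, p)" "y = (\<alpha>', p')" by (cases x; cases y)
  ultimately have "shape (pentagon m \<alpha> p) = shape (pentagon m \<alpha>' p')" by (simp add: xy)
  then show "x = y"
    by (auto simp: xy shapes bool_singleton_neq_UNIV split: if_splits)
qed

lemma card_facet_sets:
  assumes "0 < m"
  shows "card (facet_sets m) = 6 * (m + 1)"
proof -
  define F1 where "F1 = range (cap m)"
  define F2 where "F2 = range (belt m)"
  define F3 where "F3 = (\<lambda>(\<alpha>, p, r). panel \<alpha> p r) ` (UNIV \<times> UNIV \<times> {..<m})"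
  define F4 where "F4 = (\<lambda>(p, r). bridge m p r) ` (UNIV \<times> {..<m - 1})"
  define F5 where "F5 = range (\<lambda>(\<alpha>, p). pentagon m \<alpha> p)"
  note defs = F1_def F2_def F3_def F4_def F5_def
  have "facet_sets m = F1 \<union> (F2 \<union> (F3 \<union> (F4 \<union> F5)))"
  proof
    show "facet_sets m \<subseteq> F1 \<union> (F2 \<union> (F3 \<union> (F4 \<union> F5)))"
      by (rule subsetI, erule facet_sets.cases) (force simp: defs)+
    show "F1 \<union> (F2 \<union> (F3 \<union> (F4 \<union> F5))) \<subseteq> facet_sets m"
      by (auto simp: defs intro: facet_sets.intros)
  qed
  moreover have "F4 \<inter> F5 = {}" "F3 \<inter> (F4 \<union> F5) = {}" "F2 \<inter> (F3 \<union> (F4 \<union> F5)) = {}"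
    "F1 \<inter> (F2 \<union> (F3 \<union> (F4 \<union> F5))) = {}"
    by (auto simp: defs facet_families_distinct dest: sym)
  moreover have "finite F1" "finite F2" "finite F3" "finite F4" "finite F5"
    by (simp_all add: defs)
  moreover have "card F1 = 2" "card F2 = 2"
    unfolding defs using inj_cap inj_belt by (auto simp: card_image)
  moreover have "card F3 = 4 * m" unfolding F3_def
    by (subst card_image[OF inj_on_subset[OF inj_panel]]) (auto simp: card_cartesian_product)
  moreover have "card F4 = 2 * (m - 1)" unfolding F4_def
    by (subst card_image[OF inj_on_subset[OF inj_bridge]]) (auto simp: card_cartesian_product)
  moreover have "card F5 = 4" unfolding F5_def
    by (subst card_image[OF inj_pentagon]) (simp add: card_UNIV_bool_bool)
  ultimately show ?thesis using assms by (simp add: card_Un_disjoint)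
qed

section \<open>The labelled points span the Minkowski sum\<close>

definition corner :: "nat \<Rightarrow> bool \<Rightarrow> bool \<Rightarrow> bool \<Rightarrow> real^var" where
  "corner m \<alpha> \<beta> \<gamma> = homog m (of_bool \<alpha>) (real m * of_bool \<beta>) (real m * of_bool \<gamma>)"

fun summand :: "nat \<Rightarrow> nat \<Rightarrow> node \<Rightarrow> real^var" where
  "summand m l (\<alpha>, \<beta>, \<gamma>, r) =
     (if upper m (\<alpha>, \<beta>, \<gamma>, r) l then homog m 1 (real l) (real m * of_bool \<gamma>)
      else homog m 0 (real m * of_bool \<beta>) (real l))"

fun node_point :: "nat \<Rightarrow> node \<Rightarrow> real^var" where
  "node_point m (\<alpha>, \<beta>, \<gamma>, r) = corner m \<alpha> \<beta> \<gamma> + (\<Sum>l\<in>{0..m}. summand m l (\<alpha>, \<beta>, \<gamma>, r))"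

definition cuboid :: "nat \<Rightarrow> (real^var) set" where
  "cuboid m = convex hull ((\<lambda>(\<alpha>, \<beta>, \<gamma>). corner m \<alpha> \<beta> \<gamma>) ` UNIV)"

definition tetra :: "nat \<Rightarrow> nat \<Rightarrow> (real^var) set" where
  "tetra m l = convex hull {homog m 1 (real l) (real m), homog m 1 (real l) 0, homog m 0 (real m) (real l), homog m 0 0 (real l)}"

lemma newton_polytope_Q_eq:
  "newton_polytope (Q m :: 'k::{semiring_char_0, comm_semiring_1} poly6) = cuboid m"
proof -
  have "(\<lambda>(x, s, t). homog m x s t) ` ({0, 1} \<times> {0, real m} \<times> {0, real m})
      = (\<lambda>(\<alpha>, \<beta>, \<gamma>). corner m \<alpha> \<beta> \<gamma>) ` (UNIV \<times> UNIV \<times> UNIV)"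
    by (simp add: corner_def UNIV_bool insert_commute)
  then show ?thesis by (simp add: newton_polytope_Q cuboid_def)
qed

lemma newton_polytope_P_eq:
  "l \<le> m \<Longrightarrow> newton_polytope (P m l :: 'k::{semiring_char_0, comm_semiring_1} poly6) = tetra m l"
  by (simp add: newton_polytope_P tetra_def)

definition minkowski :: "nat \<Rightarrow> (real^var) set" where
  "minkowski m = cuboid m + (\<Sum>l\<in>{0..m}. tetra m l)"

text \<open>A functional on the six exponents and its three slopes differ by this constant on every summand.\<close>

definition offset :: "nat \<Rightarrow> real^var \<Rightarrow> real" where
  "offset m w = w $ X1 + real m * w $ S1 + real m * w $ T1"

text \<open>These are the values of the support functions of the summands at $w$.\<close>

definition supQ :: "nat \<Rightarrow> real^var \<Rightarrow> real" where
  "supQ m w = offset m w + max (w $ X0 - w $ X1) 0 + real m * max (w $ S0 - w $ S1) 0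
     + real m * max (w $ T0 - w $ T1) 0"

definition supP :: "nat \<Rightarrow> nat \<Rightarrow> real^var \<Rightarrow> real" where
  "supP m l w = offset m w
     + max (w $ X0 - w $ X1 + real l * (w $ S0 - w $ S1) + real m * max (w $ T0 - w $ T1) 0)
           (real m * max (w $ S0 - w $ S1) 0 + real l * (w $ T0 - w $ T1))"

abbreviation wpeak :: "nat \<Rightarrow> real^var \<Rightarrow> node set" where
  "wpeak m w \<equiv> peak m (w $ X0 - w $ X1) (w $ S0 - w $ S1) (w $ T0 - w $ T1)"

lemma inner_homog:
  "w \<bullet> homog m x s t = offset m w + (w $ X0 - w $ X1) * x + (w $ S0 - w $ S1) * s + (w $ T0 - w $ T1) * t"
  by (simp add: inner_vec_def UNIV_var homog_def offset_def algebra_simps)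

lemma mult_of_bool_le: "a * of_bool p \<le> max a 0" for a :: real
  by (auto simp: max_def)

lemma mult_of_bool_eq: "a * of_bool p = max a 0 \<longleftrightarrow> has_sign p a" for a :: real
  by (auto simp: max_def has_sign_def)

lemma inner_corner_le: "w \<bullet> corner m \<alpha> \<beta> \<gamma> \<le> supQ m w"
  using mult_of_bool_le[of "w $ X0 - w $ X1" \<alpha>]
    mult_left_mono[OF mult_of_bool_le[of "w $ S0 - w $ S1" \<beta>], of "real m"]
    mult_left_mono[OF mult_of_bool_le[of "w $ T0 - w $ T1" \<gamma>], of "real m"]
  by (simp add: corner_def inner_homog supQ_def mult.left_commute)

lemma inner_corner_eq:
  assumes "0 < m"
  shows "w \<bullet> corner m \<alpha> \<beta> \<gamma> = supQ m w \<longleftrightarrow>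
    has_sign \<alpha> (w $ X0 - w $ X1) \<and> has_sign \<beta> (w $ S0 - w $ S1) \<and> has_sign \<gamma> (w $ T0 - w $ T1)"
proof -
  have m: "real m * x = real m * y \<longleftrightarrow> x = y" for x y :: real using assms by simp
  have "w \<bullet> corner m \<alpha> \<beta> \<gamma> = supQ m w \<longleftrightarrow>
      (w $ X0 - w $ X1) * of_bool \<alpha> = max (w $ X0 - w $ X1) 0
    \<and> real m * ((w $ S0 - w $ S1) * of_bool \<beta>) = real m * max (w $ S0 - w $ S1) 0
    \<and> real m * ((w $ T0 - w $ T1) * of_bool \<gamma>) = real m * max (w $ T0 - w $ T1) 0"
    using mult_of_bool_le[of "w $ X0 - w $ X1" \<alpha>]
      mult_left_mono[OF mult_of_bool_le[of "w $ S0 - w $ S1" \<beta>], of "real m"]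
      mult_left_mono[OF mult_of_bool_le[of "w $ T0 - w $ T1" \<gamma>], of "real m"]
    unfolding corner_def inner_homog supQ_def mult.left_commute[of _ "real m"] by linarith
  then show ?thesis unfolding m mult_of_bool_eq .
qed

lemma inner_le_on_hull:
  assumes "\<And>v. v \<in> S \<Longrightarrow> w \<bullet> v \<le> c" "y \<in> convex hull S"
  shows "w \<bullet> y \<le> c"
proof -
  have "convex hull S \<subseteq> {x. w \<bullet> x \<le> c}"
    by (rule hull_minimal) (use assms(1) in \<open>auto simp: convex_halfspace_le\<close>)
  then show ?thesis using assms(2) by auto
qed

lemma inner_cuboid_le: "y \<in> cuboid m \<Longrightarrow> w \<bullet> y \<le> supQ m w"
  unfolding cuboid_def by (erule inner_le_on_hull[rotated]) (auto simp: inner_corner_le)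

lemma inner_tetra_le:
  assumes "y \<in> tetra m l"
  shows "w \<bullet> y \<le> supP m l w"
proof -
  define B where "B = real m * max (w $ S0 - w $ S1) 0"
  define C where "C = real m * max (w $ T0 - w $ T1) 0"
  have "(w $ S0 - w $ S1) * real m \<le> B" "(w $ T0 - w $ T1) * real m \<le> C" "0 \<le> B" "0 \<le> C"
    unfolding B_def C_def mult.commute[of _ "real m"] by (intro mult_left_mono mult_nonneg_nonneg; simp)+
  moreover have "supP m l w = offset m w
      + max (w $ X0 - w $ X1 + (w $ S0 - w $ S1) * real l + C) (B + (w $ T0 - w $ T1) * real l)"
    by (simp add: supP_def B_def C_def mult.commute)
  ultimately have "\<And>v. v \<in> {homog m 1 (real l) (real m), homog m 1 (real l) 0, homog m 0 (real m) (real l), homog m 0 0 (real l)}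
      \<Longrightarrow> w \<bullet> v \<le> supP m l w"
    by (auto simp: inner_homog le_max_iff_disj)
  then show ?thesis using assms unfolding tetra_def by (rule inner_le_on_hull)
qed

lemma summand_in_tetra: "summand m l i \<in> tetra m l"
  by (cases i) (auto simp: tetra_def intro!: hull_inc)

lemma corner_in_cuboid: "corner m \<alpha> \<beta> \<gamma> \<in> cuboid m"
  unfolding cuboid_def by (intro hull_inc) (auto simp: image_iff split_beta)

lemma gain_eq: "l \<le> m \<Longrightarrow> gain m l a b c = (a + real l * b + real m * max c 0) - (real m * max b 0 + real l * c)"
proof -
  assume "l \<le> m"
  have e: "max (- b) 0 = max b 0 - b" "max (- c) 0 = max c 0 - c" by (auto simp: max_def)
  show ?thesis unfolding gain_def e of_nat_diff[OF \<open>l \<le> m\<close>] by (simp add: algebra_simps)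
qed

lemma inner_summand_eq:
  assumes "l \<le> m" "has_sign \<beta> (w $ S0 - w $ S1)" "has_sign \<gamma> (w $ T0 - w $ T1)"
  shows "w \<bullet> summand m l (\<alpha>, \<beta>, \<gamma>, r) = supP m l w \<longleftrightarrow>
    has_sign (upper m (\<alpha>, \<beta>, \<gamma>, r) l) (gain m l (w $ X0 - w $ X1) (w $ S0 - w $ S1) (w $ T0 - w $ T1))"
proof -
  let ?A = "w $ X0 - w $ X1 + real l * (w $ S0 - w $ S1) + real m * max (w $ T0 - w $ T1) 0"
  let ?B = "real m * max (w $ S0 - w $ S1) 0 + real l * (w $ T0 - w $ T1)"
  have e: "(w $ S0 - w $ S1) * (real m * of_bool \<beta>) = real m * max (w $ S0 - w $ S1) 0"
    "(w $ T0 - w $ T1) * (real m * of_bool \<gamma>) = real m * max (w $ T0 - w $ T1) 0"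
    using assms(2,3) unfolding mult_of_bool_eq[symmetric] by (simp_all only: mult.left_commute[of _ "real m"])
  have "w \<bullet> summand m l (\<alpha>, \<beta>, \<gamma>, r) = offset m w + (if upper m (\<alpha>, \<beta>, \<gamma>, r) l then ?A else ?B)"
    by (simp only: summand.simps if_distrib[of "(\<bullet>) w"] inner_homog e) (simp add: mult.commute)
  moreover have "supP m l w = offset m w + max ?A ?B" by (simp add: supP_def)
  ultimately show ?thesis using gain_eq[OF assms(1)] by (auto simp: has_sign_def max_def)
qed

definition sup_total :: "nat \<Rightarrow> real^var \<Rightarrow> real" where
  "sup_total m w = supQ m w + (\<Sum>l\<in>{0..m}. supP m l w)"

lemma node_point_in_minkowski: "node_point m i \<in> minkowski m"
proof -
  have "(\<Sum>l\<in>{0..m}. summand m l i) \<in> (\<Sum>l\<in>{0..m}. tetra m l)"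
    by (subst set_sum_alt) (auto simp: summand_in_tetra)
  then show ?thesis by (cases i) (auto simp: minkowski_def intro!: set_plus_intro corner_in_cuboid simp del: summand.simps)
qed

lemma inner_minkowski_le:
  assumes "y \<in> minkowski m"
  shows "w \<bullet> y \<le> sup_total m w"
proof -
  from assms obtain u s where u: "y = u + (\<Sum>l\<in>{0..m}. s l)" "u \<in> cuboid m" "\<forall>l\<in>{0..m}. s l \<in> tetra m l"
    by (auto simp: minkowski_def set_plus_def set_sum_alt)
  have "(\<Sum>l\<in>{0..m}. w \<bullet> s l) \<le> (\<Sum>l\<in>{0..m}. supP m l w)"
    using u(3) by (intro sum_mono inner_tetra_le) auto
  then show ?thesis
    using inner_cuboid_le[OF u(2), of w] by (simp add: u(1) inner_add_right inner_sum_right sup_total_def)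
qed

text \<open>A functional is maximal on a sum of points exactly if it is maximal at each of them, so the maximal nodes are those whose
normal cone contains its slopes.\<close>

lemma inner_node_point_eq:
  assumes "0 < m" "i \<in> nodes m"
  shows "w \<bullet> node_point m i = sup_total m w \<longleftrightarrow> i \<in> wpeak m w"
proof -
  obtain \<alpha> \<beta> \<gamma> r where i: "i = (\<alpha>, \<beta>, \<gamma>, r)" by (cases i)
  have P: "w \<bullet> summand m l i \<le> supP m l w" for l by (rule inner_tetra_le[OF summand_in_tetra])
  have "(\<Sum>l\<in>{0..m}. w \<bullet> summand m l i) \<le> (\<Sum>l\<in>{0..m}. supP m l w)"
    using P by (intro sum_mono)
  then have "w \<bullet> node_point m i = sup_total m w \<longleftrightarrow> w \<bullet> corner m \<alpha> \<beta> \<gamma> = supQ m w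
      \<and> (\<Sum>l\<in>{0..m}. w \<bullet> summand m l i) = (\<Sum>l\<in>{0..m}. supP m l w)"
    using inner_corner_le[of w m \<alpha> \<beta> \<gamma>]
    by (auto simp: i inner_add_right inner_sum_right sup_total_def simp del: summand.simps)
  also have "(\<Sum>l\<in>{0..m}. w \<bullet> summand m l i) = (\<Sum>l\<in>{0..m}. supP m l w)
      \<longleftrightarrow> (\<forall>l\<in>{0..m}. w \<bullet> summand m l i = supP m l w)"
    using P sum_mono_inv[of "\<lambda>l. w \<bullet> summand m l i" "{0..m}" "\<lambda>l. supP m l w"] by auto
  finally show ?thesis
    using inner_summand_eq[of _ m \<beta> w \<gamma> \<alpha> r] assms(2)
    by (auto simp: peak_def i inner_corner_eq[OF assms(1)] simp del: summand.simps upper.simps)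
qed

lemma cells_nonempty: "0 < m \<Longrightarrow> W \<in> cells m \<Longrightarrow> W \<noteq> {}"
  using card_facet_set[of m W] card_edge_set[of W m] card_nodes[of m] by (auto simp: cells_def)

lemma wpeak_nonempty: "0 < m \<Longrightarrow> wpeak m w \<noteq> {}"
  using cells_nonempty[OF _ peak_cells] by blast

lemma peak_subset: "peak m a b c \<subseteq> nodes m"
  by (auto simp: peak_def)

lemma extremal_node_point:
  assumes "0 < m"
  shows "{j \<in> nodes m. \<forall>k\<in>nodes m. w \<bullet> node_point m k \<le> w \<bullet> node_point m j} = wpeak m w"
proof -
  obtain i where i: "i \<in> wpeak m w" using wpeak_nonempty[OF assms] by blast
  then have n: "i \<in> nodes m" by (auto simp: peak_def)
  have "w \<bullet> node_point m i = sup_total m w" by (rule iffD2[OF inner_node_point_eq[OF assms n] i])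
  then have "(\<forall>k\<in>nodes m. w \<bullet> node_point m k \<le> w \<bullet> node_point m j) \<longleftrightarrow> w \<bullet> node_point m j = sup_total m w" if "j \<in> nodes m" for j
    using inner_minkowski_le[OF node_point_in_minkowski, of w m] n by (metis order_antisym)
  then have "j \<in> nodes m \<and> (\<forall>k\<in>nodes m. w \<bullet> node_point m k \<le> w \<bullet> node_point m j) \<longleftrightarrow> j \<in> wpeak m w" for j
    using inner_node_point_eq[OF assms, of j w] peak_subset by blast
  then show ?thesis by blast
qed

text \<open>Every functional attains its maximum over the Minkowski sum at some labelled point, because no peak is empty; a point of
the sum outside the hull of the labelled points could be separated from it.\<close>

lemma minkowski_eq_hull:
  assumes "0 < m"
  shows "minkowski m = convex hull (node_point m ` nodes m)"
proof
  have "convex (minkowski m)"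
    unfolding minkowski_def cuboid_def tetra_def by (intro convex_set_plus convex_set_sum convex_convex_hull)
  then show "convex hull (node_point m ` nodes m) \<subseteq> minkowski m"
    using node_point_in_minkowski by (intro hull_minimal) auto
  show "minkowski m \<subseteq> convex hull (node_point m ` nodes m)"
  proof (rule ccontr)
    assume "\<not> ?thesis"
    then obtain y where y: "y \<in> minkowski m" "y \<notin> convex hull (node_point m ` nodes m)" by blast
    have "closed (convex hull (node_point m ` nodes m))"
      using finite_nodes by (intro compact_imp_closed compact_convex_hull finite_imp_compact) simp
    then obtain w c where w: "w \<bullet> y < c" "\<forall>x\<in>convex hull (node_point m ` nodes m). c < w \<bullet> x"
      using separating_hyperplane_closed_point[of "convex hull (node_point m ` nodes m)" y] y(2) by auto
    obtain i where i: "i \<in> wpeak m (- w)" using wpeak_nonempty[OF assms] by blast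
    then have n: "i \<in> nodes m" by (auto simp: peak_def)
    have "(- w) \<bullet> node_point m i = sup_total m (- w)" by (rule iffD2[OF inner_node_point_eq[OF assms n] i])
    then have "(- w) \<bullet> y \<le> (- w) \<bullet> node_point m i" using inner_minkowski_le[OF y(1), of "- w"] by (simp only:)
    moreover have "c < w \<bullet> node_point m i" using w(2) n by (auto intro: hull_inc)
    ultimately show False using w(1) by simp
  qed
qed

definition direction :: "real \<Rightarrow> real \<Rightarrow> real \<Rightarrow> real^var" where
  "direction a b c = (\<chi> i. case i of X0 \<Rightarrow> a | X1 \<Rightarrow> 0 | S0 \<Rightarrow> b | S1 \<Rightarrow> 0 | T0 \<Rightarrow> c | T1 \<Rightarrow> 0)"

lemma wpeak_direction: "wpeak m (direction a b c) = peak m a b c"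
  by (simp add: direction_def)

lemma convex_position_node_point:
  assumes "0 < m"
  shows "convex_position (nodes m) (node_point m)"
proof
  show "finite (nodes m)" by (rule finite_nodes)
  show "nodes m \<noteq> {}" using card_nodes[of m] by force
  fix i assume "i \<in> nodes m"
  then obtain a b c where "peak m a b c = {i}"
    using singleton_peaks[OF assms, of i] unfolding peaks_def mem_Collect_eq by metis
  then have "wpeak m (direction a b c) = {i}" by (simp add: wpeak_direction)
  then show "\<exists>w. {j \<in> nodes m. \<forall>k\<in>nodes m. w \<bullet> node_point m k \<le> w \<bullet> node_point m j} = {i}"
    unfolding extremal_node_point[OF assms] by blast
qed

lemma range_extremal_node_point:
  assumes "0 < m"
  shows "range (convex_position.extremal (nodes m) (node_point m)) = peaks m"
proof -
  interpret convex_position "nodes m" "node_point m" by (rule convex_position_node_point[OF assms])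
  have "extremal w = wpeak m w" for w unfolding extremal_def by (rule extremal_node_point[OF assms])
  then show ?thesis by (auto simp: peaks_def image_iff) (metis wpeak_direction)
qed

lemma convex_position_corner:
  assumes "0 < m"
  shows "convex_position UNIV (\<lambda>(\<alpha>, \<beta>, \<gamma>). corner m \<alpha> \<beta> \<gamma>)"
proof
  fix i :: "bool \<times> bool \<times> bool"
  obtain \<alpha> \<beta> \<gamma> where i: "i = (\<alpha>, \<beta>, \<gamma>)" by (cases i)
  define s where "s p = (if p then 1 else - 1 :: real)" for p
  let ?w = "direction (s \<alpha>) (s \<beta>) (s \<gamma>)"
  have has_sign: "has_sign p (s q) \<longleftrightarrow> p = q" for p q by (auto simp: has_sign_def s_def)
  have eq: "?w \<bullet> corner m \<alpha>' \<beta>' \<gamma>' = supQ m ?w \<longleftrightarrow> (\<alpha>', \<beta>', \<gamma>') = i" for \<alpha>' \<beta>' \<gamma>'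
    by (simp add: inner_corner_eq[OF assms] i direction_def has_sign)
  have "(\<forall>k\<in>UNIV. ?w \<bullet> (case k of (\<alpha>, \<beta>, \<gamma>) \<Rightarrow> corner m \<alpha> \<beta> \<gamma>) \<le> ?w \<bullet> corner m \<alpha>' \<beta>' \<gamma>')
      \<longleftrightarrow> ?w \<bullet> corner m \<alpha>' \<beta>' \<gamma>' = supQ m ?w" for \<alpha>' \<beta>' \<gamma>'
  proof
    assume "\<forall>k\<in>UNIV. ?w \<bullet> (case k of (\<alpha>, \<beta>, \<gamma>) \<Rightarrow> corner m \<alpha> \<beta> \<gamma>) \<le> ?w \<bullet> corner m \<alpha>' \<beta>' \<gamma>'"
    then have "?w \<bullet> (case i of (\<alpha>, \<beta>, \<gamma>) \<Rightarrow> corner m \<alpha> \<beta> \<gamma>) \<le> ?w \<bullet> corner m \<alpha>' \<beta>' \<gamma>'" by blast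
    then have "supQ m ?w \<le> ?w \<bullet> corner m \<alpha>' \<beta>' \<gamma>'" using eq[of \<alpha> \<beta> \<gamma>] i by simp
    then show "?w \<bullet> corner m \<alpha>' \<beta>' \<gamma>' = supQ m ?w" using inner_corner_le by (rule order_antisym[rotated])
  qed (auto simp: inner_corner_le)
  note optimal = this
  have "{j \<in> UNIV. \<forall>k\<in>UNIV. ?w \<bullet> (case k of (\<alpha>, \<beta>, \<gamma>) \<Rightarrow> corner m \<alpha> \<beta> \<gamma>)
      \<le> ?w \<bullet> (case j of (\<alpha>, \<beta>, \<gamma>) \<Rightarrow> corner m \<alpha> \<beta> \<gamma>)} = {i}"
  proof (rule set_eqI)
    fix j :: "bool \<times> bool \<times> bool"
    obtain \<alpha>' \<beta>' \<gamma>' where j: "j = (\<alpha>', \<beta>', \<gamma>')" by (cases j)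
    show "j \<in> {j \<in> UNIV. \<forall>k\<in>UNIV. ?w \<bullet> (case k of (\<alpha>, \<beta>, \<gamma>) \<Rightarrow> corner m \<alpha> \<beta> \<gamma>)
      \<le> ?w \<bullet> (case j of (\<alpha>, \<beta>, \<gamma>) \<Rightarrow> corner m \<alpha> \<beta> \<gamma>)} \<longleftrightarrow> j \<in> {i}"
      unfolding j using optimal[of \<alpha>' \<beta>' \<gamma>'] eq[of \<alpha>' \<beta>' \<gamma>'] by (simp only: mem_Collect_eq prod.case singleton_iff UNIV_I simp_thms)
  qed
  then show "\<exists>w. {j \<in> UNIV. \<forall>k\<in>UNIV. w \<bullet> (case k of (\<alpha>, \<beta>, \<gamma>) \<Rightarrow> corner m \<alpha> \<beta> \<gamma>)
      \<le> w \<bullet> (case j of (\<alpha>, \<beta>, \<gamma>) \<Rightarrow> corner m \<alpha> \<beta> \<gamma>)} = {i}" by blast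
qed auto

section \<open>The combinatorial cube and the dimension\<close>

text \<open>The linear part of the parametrization of the exponents by $(x, s, t)$, with $s$ and $t$ scaled by $k$: for $k = m$ it maps
the unit cube to a translate of the cuboid.\<close>

definition lift :: "real \<Rightarrow> real^3 \<Rightarrow> real^var" where
  "lift k y = (\<chi> i. case i of X0 \<Rightarrow> y $ 1 | X1 \<Rightarrow> - (y $ 1) | S0 \<Rightarrow> k * y $ 2 | S1 \<Rightarrow> - (k * y $ 2)
     | T0 \<Rightarrow> k * y $ 3 | T1 \<Rightarrow> - (k * y $ 3))"

lemma linear_lift: "linear (lift k)"
  by (rule linearI) (simp_all add: lift_def vec_eq_iff all_var algebra_simps)

lemma inj_lift: "k \<noteq> 0 \<Longrightarrow> inj (lift k)"
  by (rule injI) (auto simp: lift_def vec_eq_iff all_var forall_3)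

lemma corner_eq_lift:
  "corner m \<alpha> \<beta> \<gamma> = homog m 0 0 0 + lift (real m) (vector [of_bool \<alpha>, of_bool \<beta>, of_bool \<gamma>])"
  by (simp add: corner_def homog_def lift_def vec_eq_iff all_var)

lemma homog_eq_lift: "homog m x s t = homog m 0 0 0 + lift 1 (vector [x, s, t])"
  by (simp add: homog_def lift_def vec_eq_iff all_var)

lemma cbox_cart_eq_hull: "cbox (0 :: real^'n) 1 = convex hull {x. \<forall>i. x $ i = 0 \<or> x $ i = 1}"
proof -
  have "(1 :: real^'n) = One"
  proof (rule euclidean_eqI)
    fix b :: "real^'n" assume "b \<in> Basis"
    then have "One \<bullet> b = 1" by (simp add: inner_sum_left sum.If_cases inner_Basis)
    moreover have "1 \<bullet> b = 1" using \<open>b \<in> Basis\<close> by (auto simp: Basis_vec_def inner_axis)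
    ultimately show "1 \<bullet> b = One \<bullet> b" by simp
  qed
  moreover have "{x :: real^'n. \<forall>i. x $ i = 0 \<or> x $ i = 1} = {x. \<forall>i\<in>Basis. x \<bullet> i = 0 \<or> x \<bullet> i = 1}"
    by (simp add: Basis_vec_def inner_axis)
  ultimately show ?thesis using unit_interval_convex_hull[where 'a = "real^'n"] by simp
qed

lemma cuboid_eq_cube: "cuboid m = (+) (homog m 0 0 0) ` lift (real m) ` cbox 0 1"
proof -
  have "{x :: real^3. \<forall>i. x $ i = 0 \<or> x $ i = 1}
      = (\<lambda>(\<alpha>, \<beta>, \<gamma>). vector [of_bool \<alpha>, of_bool \<beta>, of_bool \<gamma>]) ` (UNIV :: (bool \<times> bool \<times> bool) set)"
    (is "?L = ?R")
  proof
    show "?L \<subseteq> ?R"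
    proof
      fix x :: "real^3" assume "x \<in> ?L"
      then have "x = vector [of_bool (x $ 1 = 1), of_bool (x $ 2 = 1), of_bool (x $ 3 = 1)]"
        by (auto simp: vec_eq_iff forall_3)
      then show "x \<in> ?R" by (intro image_eqI[of _ _ "(x $ 1 = 1, x $ 2 = 1, x $ 3 = 1)"]) simp_all
    qed
  qed (auto simp: forall_3)
  then have "(cbox 0 1 :: (real^3) set) = convex hull ((\<lambda>(\<alpha>, \<beta>, \<gamma>). vector [of_bool \<alpha>, of_bool \<beta>, of_bool \<gamma>]) ` UNIV)"
    unfolding cbox_cart_eq_hull by (simp only:)
  then show ?thesis
    unfolding cuboid_def
    by (simp only: convex_hull_linear_image[OF linear_lift] convex_hull_translation[symmetric] image_image)
      (simp add: corner_eq_lift split_beta)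
qed

lemma combinatorially_equivalent_affine_image:
  fixes f :: "'a::euclidean_space \<Rightarrow> 'b::euclidean_space"
  assumes "linear f" "inj f"
  shows "combinatorially_equivalent ((+) a ` f ` K) K"
proof -
  define h where "h y = a + f y" for y
  have h: "(+) a ` f ` K = h ` K" for K by (simp add: h_def image_image)
  have inj: "inj h" using assms(2) by (auto simp: h_def inj_def)
  have face: "h ` G face_of h ` K \<longleftrightarrow> G face_of K" for G
    unfolding h[symmetric] by (simp add: face_of_linear_image assms)
  have faces: "\<exists>G. G face_of K \<and> F = h ` G" if "F face_of h ` K" for F
  proof -
    have "F \<subseteq> h ` K" using that by (rule face_of_imp_subset)
    then obtain G where "F = h ` G" by (metis subset_image_iff)
    then show ?thesis using that face by blast
  qed
  have vimage: "h -` h ` G = G" for G by (rule inj_vimage_image_eq[OF inj])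
  have "bij_betw ((-`) h) {F. F face_of h ` K} {G. G face_of K}"
  proof (rule bij_betw_byWitness[where f' = "image h"])
    show "\<forall>F\<in>{F. F face_of h ` K}. h ` h -` F = F" using faces vimage by blast
    show "\<forall>G\<in>{G. G face_of K}. h -` h ` G = G" using vimage by blast
    show "(-`) h ` {F. F face_of h ` K} \<subseteq> {G. G face_of K}" using faces vimage by fastforce
    show "(`) h ` {G. G face_of K} \<subseteq> {F. F face_of h ` K}" using face by blast
  qed
  moreover have "\<forall>F F'. F face_of h ` K \<longrightarrow> F' face_of h ` K \<longrightarrow> (F \<subseteq> F' \<longleftrightarrow> h -` F \<subseteq> h -` F')"
  proof (intro allI impI)
    fix F F' assume FF: "F face_of h ` K" "F' face_of h ` K"
    obtain G where G: "F = h ` G" using faces[OF FF(1)] by blast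
    obtain G' where G': "F' = h ` G'" using faces[OF FF(2)] by blast
    show "F \<subseteq> F' \<longleftrightarrow> h -` F \<subseteq> h -` F'" unfolding G G' vimage by (rule inj_image_subset_iff[OF inj])
  qed
  ultimately show ?thesis unfolding combinatorially_equivalent_def h by blast
qed

lemma combinatorial_cube_cuboid:
  assumes "0 < m"
  shows "combinatorial_cube (cuboid m)"
  unfolding combinatorial_cube_def
proof
  show "polytope (cuboid m)" unfolding cuboid_def by (intro polytope_convex_hull) simp
  show "combinatorially_equivalent (cuboid m) (cbox 0 1 :: (real^3) set)"
    unfolding cuboid_eq_cube
    using assms by (intro combinatorially_equivalent_affine_image linear_lift inj_lift) simp
qed

lemma aff_dim_minkowski_le:
  assumes "0 < m"
  shows "aff_dim (minkowski m) \<le> 3"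
proof -
  define b where "b = homog m 0 0 0 + (\<Sum>l\<in>{0..m}. homog m 0 0 0)"
  have homog: "\<exists>y. homog m x s t = homog m 0 0 0 + lift 1 y" for x s t using homog_eq_lift by blast
  have "node_point m i \<in> (+) b ` range (lift 1)" for i
  proof -
    obtain \<alpha> \<beta> \<gamma> r where i: "i = (\<alpha>, \<beta>, \<gamma>, r)" by (cases i)
    obtain y where y: "corner m \<alpha> \<beta> \<gamma> = homog m 0 0 0 + lift 1 y" unfolding corner_def using homog by blast
    have "\<exists>z. summand m l i = homog m 0 0 0 + lift 1 z" for l unfolding i summand.simps using homog by metis
    then obtain z where z: "\<And>l. summand m l i = homog m 0 0 0 + lift 1 (z l)" by metis
    have "node_point m i = b + lift 1 (y + (\<Sum>l\<in>{0..m}. z l))"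
      unfolding i node_point.simps y
      by (simp add: z[unfolded i] b_def sum.distrib linear_add[OF linear_lift] linear_sum[OF linear_lift] del: summand.simps)
    then show ?thesis by blast
  qed
  then have "node_point m ` nodes m \<subseteq> (+) b ` range (lift 1)" by blast
  then have "aff_dim (minkowski m) \<le> aff_dim ((+) b ` range (lift 1))"
    unfolding minkowski_eq_hull[OF assms] aff_dim_convex_hull by (rule aff_dim_subset)
  also have "\<dots> = aff_dim (range (lift 1))" by (rule aff_dim_translation_eq)
  also have "\<dots> \<le> aff_dim (UNIV :: (real^3) set)" by (rule aff_dim_linear_image_le[OF linear_lift])
  finally show ?thesis by simp
qed

section \<open>Vertices over a vertex of the cuboid\<close>

lemma node_point_extreme_imp_summand_vertices:
  assumes "node_point m (\<alpha>, \<beta>, \<gamma>, r) \<in> vertices (minkowski m)" "l \<le> m"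
  shows "summand m l (\<alpha>, \<beta>, \<gamma>, r) \<in> vertices (tetra m l)"
proof -
  let ?S = "\<Sum>l\<in>{0..m}. tetra m l" and ?s = "\<Sum>l\<in>{0..m}. summand m l (\<alpha>, \<beta>, \<gamma>, r)"
  have s: "?s \<in> ?S" by (subst set_sum_alt) (auto simp: summand_in_tetra simp del: summand.simps)
  have "?s extreme_point_of ?S"
  proof (rule extreme_point_of_plus)
    show "node_point m (\<alpha>, \<beta>, \<gamma>, r) extreme_point_of ?S + cuboid m"
      using assms(1) by (simp add: vertices_def minkowski_def add.commute)
    show "node_point m (\<alpha>, \<beta>, \<gamma>, r) = ?s + corner m \<alpha> \<beta> \<gamma>" by (simp add: add.commute del: summand.simps)
  qed (rule s, rule corner_in_cuboid)
  then have "summand m l (\<alpha>, \<beta>, \<gamma>, r) extreme_point_of tetra m l"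
    using extreme_points_of_sum[where A = "{0..m}" and S = "tetra m" and v = ?s and j = l
        and x = "\<lambda>l. summand m l (\<alpha>, \<beta>, \<gamma>, r)"] assms(2) summand_in_tetra
    by (simp del: summand.simps)
  then show ?thesis by (simp add: vertices_def)
qed

lemma vertices_cuboid: "0 < m \<Longrightarrow> vertices (cuboid m) = (\<lambda>(\<alpha>, \<beta>, \<gamma>). corner m \<alpha> \<beta> \<gamma>) ` UNIV"
  unfolding cuboid_def
  using convex_position.vertices_hull_of[OF convex_position_corner, of m UNIV] by simp

lemma vertices_minkowski: "0 < m \<Longrightarrow> vertices (minkowski m) = node_point m ` nodes m"
  unfolding minkowski_eq_hull
  using convex_position.vertices_hull_of[OF convex_position_node_point, of m "nodes m"] by simp

lemma corner_inject:
  assumes "0 < m" "corner m \<alpha> \<beta> \<gamma> = corner m \<alpha>' \<beta>' \<gamma>'"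
  shows "\<alpha> = \<alpha>' \<and> \<beta> = \<beta>' \<and> \<gamma> = \<gamma>'"
  using inj_onD[OF convex_position.inj_pt[OF convex_position_corner[OF assms(1)]], of "(\<alpha>, \<beta>, \<gamma>)" "(\<alpha>', \<beta>', \<gamma>')"]
    assms(2) by simp

text \<open>The construction of a labelled point displays one decomposition into vertices; since decompositions of an extreme point are
unique, its component in the cuboid is the corner given by the three signs.\<close>

lemma vertices_above_corner:
  assumes "0 < m"
  shows "{v \<in> vertices (minkowski m). is_summand_of (cuboid m) {0..m} (tetra m) (corner m \<alpha> \<beta> \<gamma>) v}
    = node_point m ` ({\<alpha>} \<times> {\<beta>} \<times> {\<gamma>} \<times> {..m})"
    (is "?L = ?R")
proof
  show "?L \<subseteq> ?R"
  proof
    fix v assume "v \<in> ?L"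
    then have v: "v \<in> vertices (minkowski m)" "is_summand_of (cuboid m) {0..m} (tetra m) (corner m \<alpha> \<beta> \<gamma>) v" by auto
    then obtain w where w: "\<forall>l\<in>{0..m}. w l \<in> vertices (tetra m l)" "v = corner m \<alpha> \<beta> \<gamma> + (\<Sum>l\<in>{0..m}. w l)"
      by (auto simp: is_summand_of_def)
    from v(1) obtain \<alpha>' \<beta>' \<gamma>' r where r: "r \<le> m" "v = node_point m (\<alpha>', \<beta>', \<gamma>', r)"
      unfolding vertices_minkowski[OF assms] by (auto simp: nodes_def simp del: node_point.simps)
    let ?S = "\<Sum>l\<in>{0..m}. tetra m l"
    have "corner m \<alpha> \<beta> \<gamma> = corner m \<alpha>' \<beta>' \<gamma>'"
    proof (rule extreme_point_of_plus_unique)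
      show "v extreme_point_of cuboid m + ?S" using v(1) by (simp add: vertices_def minkowski_def)
      show "v = corner m \<alpha>' \<beta>' \<gamma>' + (\<Sum>l\<in>{0..m}. summand m l (\<alpha>', \<beta>', \<gamma>', r))" by (simp only: r node_point.simps)
      show "(\<Sum>l\<in>{0..m}. w l) \<in> ?S"
        using w(1) by (subst set_sum_alt) (auto simp: vertices_def extreme_point_of_def)
      show "(\<Sum>l\<in>{0..m}. summand m l (\<alpha>', \<beta>', \<gamma>', r)) \<in> ?S"
        by (subst set_sum_alt) (auto simp: summand_in_tetra simp del: summand.simps)
    qed (rule w(2), (rule corner_in_cuboid)+)
    from corner_inject[OF assms this] have "(\<alpha>', \<beta>', \<gamma>', r) \<in> {\<alpha>} \<times> {\<beta>} \<times> {\<gamma>} \<times> {..m}"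
      using r(1) by simp
    then show "v \<in> ?R" unfolding r(2) by (rule imageI)
  qed
  show "?R \<subseteq> ?L"
  proof
    fix v assume "v \<in> ?R"
    then obtain r where r: "r \<le> m" "v = node_point m (\<alpha>, \<beta>, \<gamma>, r)" by auto
    then have v: "v \<in> vertices (minkowski m)" by (auto simp: vertices_minkowski[OF assms] nodes_def simp del: node_point.simps)
    moreover have "corner m \<alpha> \<beta> \<gamma> \<in> vertices (cuboid m)" unfolding vertices_cuboid[OF assms]
      by (rule image_eqI[of _ _ "(\<alpha>, \<beta>, \<gamma>)"]) simp_all
    moreover have "\<forall>l\<in>{0..m}. summand m l (\<alpha>, \<beta>, \<gamma>, r) \<in> vertices (tetra m l)"
      using node_point_extreme_imp_summand_vertices v r by auto
    moreover have "v = corner m \<alpha> \<beta> \<gamma> + (\<Sum>l\<in>{0..m}. summand m l (\<alpha>, \<beta>, \<gamma>, r))" by (simp only: r node_point.simps)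
    ultimately show "v \<in> ?L"
      unfolding is_summand_of_def minkowski_def mem_Collect_eq
      by (intro conjI exI[of _ "\<lambda>l. summand m l (\<alpha>, \<beta>, \<gamma>, r)"])
  qed
qed

section \<open>The face numbers of the Minkowski sum\<close>

theorem theorem5p8:
  fixes m :: nat
  assumes "m \<ge> 1"
  shows
    "let NQ = newton_polytope (Q m :: 'k::field_char_0 poly6);
         NP = (\<lambda>l. newton_polytope (P m l :: 'k poly6));
         M = NQ + (\<Sum>l\<in>{0..m}. NP l)
     in polytope M \<and> aff_dim M = 3 \<and>
        card (vertices M) = 8 * (m + 1) \<and>
        card (edges M) = 14 * m + 12 \<and>
        card (facets M) = 6 * (m + 1) \<and>
        combinatorial_cube NQ \<and> card (vertices NQ) = 8 \<and>
        (\<forall>u \<in> vertices NQ. card {v \<in> vertices M. is_summand_of NQ {0..m} NP u v} = m + 1) \<and>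
        (\<exists>A B. A \<subseteq> facets M \<and> B \<subseteq> facets M \<and> A \<inter> B = {} \<and>
           card A = 4 \<and> (\<forall>F \<in> A. is_ngon 5 F) \<and>
           card B = 2 \<and> (\<forall>F \<in> B. is_ngon (2 * (m + 1)) F) \<and>
           (\<forall>F \<in> facets M - (A \<union> B). is_ngon 4 F))"
proof -
  have m: "0 < m" using assms by simp
  interpret convex_position "nodes m" "node_point m" by (rule convex_position_node_point[OF m])
  let ?M = "minkowski m"
  have M: "?M = hull_of (nodes m)" by (rule minkowski_eq_hull[OF m])
  have range: "range extremal = peaks m" by (rule range_extremal_node_point[OF m])
  have sub: "W \<subseteq> nodes m" if "W \<in> peaks m" for W
    using that peak_subset unfolding peaks_def by blast
  have inj: "inj_on hull_of (peaks m)"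
    by (rule inj_onI) (use hull_of_inject sub in blast)
  have dim: "aff_dim ?M = 3"
  proof -
    obtain w where "extremal w = cap m True"
      using facet_peaks[OF m facet_sets.caps, of True] unfolding range[symmetric] by blast
    moreover have "card (cap m True) = 4" "card (nodes m) \<noteq> 4" using m by (simp_all add: card_cap card_nodes)
    ultimately have "3 \<le> card (extremal w)" "extremal w \<noteq> nodes m" by auto
    then have "3 \<le> aff_dim (hull_of (nodes m))" by (rule aff_dim_ge_3)
    then show ?thesis using aff_dim_minkowski_le[OF m] M by simp
  qed
  have edges: "edges ?M = hull_of ` edge_sets m"
    unfolding M edges_hull range peaks_card_2[OF m] ..
  have facets: "facets ?M = hull_of ` facet_sets m"
    using facets_hull dim unfolding M range peaks_card_ge_3[OF m] .
  have inj_facets: "inj_on hull_of (facet_sets m)"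
    by (rule inj_on_subset[OF inj]) (use facet_peaks[OF m] in blast)
  have ngon: "is_ngon (card W) (hull_of W)" if "W \<in> facet_sets m" for W
  proof -
    have W: "W \<subseteq> nodes m" using sub facet_peaks[OF m that] .
    have "hull_of W \<in> facets ?M" unfolding facets using that by blast
    then have "aff_dim (hull_of W) = 2" using dim by (simp add: facets_def facet_of_def)
    then show ?thesis using polytope_hull_of[OF W] card_vertices_hull_of[OF W] by (simp add: is_ngon_def)
  qed
  let ?A = "hull_of ` range (\<lambda>(\<alpha>, p). pentagon m \<alpha> p)" and ?B = "hull_of ` range (belt m)"
  have pentagons: "range (\<lambda>(\<alpha>, p). pentagon m \<alpha> p) \<subseteq> facet_sets m" and belts: "range (belt m) \<subseteq> facet_sets m"
    by (auto intro: facet_sets.intros)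
  have "card ?A = 4"
    by (simp add: card_image[OF inj_on_subset[OF inj_facets pentagons]] card_image[OF inj_pentagon] card_UNIV_bool_bool)
  moreover have "card ?B = 2"
    by (simp add: card_image[OF inj_on_subset[OF inj_facets belts]] card_image[OF inj_belt])
  moreover have "?A \<inter> ?B = {}"
  proof -
    have "range (\<lambda>(\<alpha>, p). pentagon m \<alpha> p) \<inter> range (belt m) = {}"
      using facet_families_distinct(7) by fastforce
    then show ?thesis using inj_on_image_Int[OF inj_facets pentagons belts] by simp
  qed
  moreover have "\<forall>F\<in>?A. is_ngon 5 F"
    using ngon[OF facet_sets.pentagons] card_pentagon[OF m] by fastforce
  moreover have "\<forall>F\<in>?B. is_ngon (2 * (m + 1)) F"
    using ngon[OF facet_sets.belts] card_belt by fastforce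
  moreover have "\<forall>F\<in>facets ?M - (?A \<union> ?B). is_ngon 4 F"
  proof
    fix F assume F: "F \<in> facets ?M - (?A \<union> ?B)"
    from F obtain W where W: "W \<in> facet_sets m" "F = hull_of W" unfolding facets by blast
    have "card W = 4" using W(1)
    proof (cases rule: facet_sets.cases)
      case (belts \<beta>)
      then show ?thesis using F W(2) by blast
    next
      case (pentagons \<alpha> p)
      then have "F \<in> ?A" unfolding W(2) by (intro imageI) (auto intro: rev_image_eqI[of "(\<alpha>, p)"])
      then show ?thesis using F by blast
    qed (simp_all add: card_cap card_panel card_bridge)
    then show "is_ngon 4 F" using ngon[OF W(1)] W(2) by simp
  qed
  moreover have "?A \<subseteq> facets ?M" "?B \<subseteq> facets ?M" unfolding facets using pentagons belts by blast+
  ultimately have AB: "\<exists>A B. A \<subseteq> facets ?M \<and> B \<subseteq> facets ?M \<and> A \<inter> B = {} \<and>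
           card A = 4 \<and> (\<forall>F \<in> A. is_ngon 5 F) \<and>
           card B = 2 \<and> (\<forall>F \<in> B. is_ngon (2 * (m + 1)) F) \<and>
           (\<forall>F \<in> facets ?M - (A \<union> B). is_ngon 4 F)" by (intro exI[of _ ?A] exI[of _ ?B] conjI)
  have summands: "\<forall>u \<in> vertices (cuboid m). card {v \<in> vertices ?M. is_summand_of (cuboid m) {0..m} (tetra m) u v} = m + 1"
  proof
    fix u assume "u \<in> vertices (cuboid m)"
    then obtain \<alpha> \<beta> \<gamma> where u: "u = corner m \<alpha> \<beta> \<gamma>" unfolding vertices_cuboid[OF m] by auto
    have "inj_on (node_point m) ({\<alpha>} \<times> {\<beta>} \<times> {\<gamma>} \<times> {..m})"
      by (rule inj_on_subset[OF inj_pt]) (auto simp: nodes_def)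
    then show "card {v \<in> vertices ?M. is_summand_of (cuboid m) {0..m} (tetra m) u v} = m + 1"
      unfolding u vertices_above_corner[OF m] by (simp add: card_image card_cartesian_product)
  qed
  have sum_tetra: "(\<Sum>l\<in>{0..m}. newton_polytope (P m l :: 'k poly6)) = (\<Sum>l\<in>{0..m}. tetra m l)"
    by (rule sum.cong) (simp_all add: newton_polytope_P_eq)
  have "card (vertices (cuboid m)) = 8"
    unfolding vertices_cuboid[OF m]
    using convex_position.inj_pt[OF convex_position_corner[OF m]]
    by (simp add: card_image)
  moreover have "card (vertices ?M) = 8 * (m + 1)"
    unfolding M by (simp add: card_vertices_hull_of card_nodes)
  moreover have "card (edges ?M) = 14 * m + 12"
    unfolding edges card_edge_sets[OF m, symmetric]
    by (rule card_image, rule inj_on_subset[OF inj]) (use edge_peaks[OF m] in blast)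
  moreover have "card (facets ?M) = 6 * (m + 1)"
    unfolding facets card_facet_sets[OF m, symmetric] by (rule card_image[OF inj_facets])
  moreover have "polytope ?M" unfolding M by (rule polytope_hull_of) simp
  moreover have "newton_polytope (Q m :: 'k poly6) = cuboid m" by (rule newton_polytope_Q_eq)
  moreover have "is_summand_of (cuboid m) {0..m} (\<lambda>l. newton_polytope (P m l :: 'k poly6)) = is_summand_of (cuboid m) {0..m} (tetra m)"
  proof (intro ext)
    have "(\<forall>l\<in>{0..m}. w l \<in> vertices (newton_polytope (P m l :: 'k poly6)))
        \<longleftrightarrow> (\<forall>l\<in>{0..m}. w l \<in> vertices (tetra m l))" for w
      by (simp add: newton_polytope_P_eq)
    then show "is_summand_of (cuboid m) {0..m} (\<lambda>l. newton_polytope (P m l :: 'k poly6)) u v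
        = is_summand_of (cuboid m) {0..m} (tetra m) u v" for u v
      unfolding is_summand_of_def sum_tetra by (simp only:)
  qed
  moreover have "cuboid m + (\<Sum>l\<in>{0..m}. newton_polytope (P m l :: 'k poly6)) = ?M"
    unfolding minkowski_def sum_tetra ..
  ultimately show ?thesis
    unfolding Let_def using dim AB summands combinatorial_cube_cuboid[OF m] by (simp only: simp_thms)
qed

end
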